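(* Let $w$ be a Robinsonian graphon satisfying Assumptions (A1)–(A4). Then the eigenspace of the graphon-Laplacian $\mathbb{L}$ corresponding to the Fiedler value $\lambda_2$ is one-dimensional.
   Context: A graphon is a measurable symmetric function $w:[0,1]^2\to[0,1]$. It is Robinsonian if for all $x,y,z\in[0,1]$: $y<z<x\Rightarrow w(x,y)\le w(x,z)$ and $x<y<z\Rightarrow w(x,y)\ge w(x,z)$. The degree function is $d(x)=\int_0^1 w(x,y)\,dy$. The graphon-Laplacian is the bounded self-adjoint positive operator on $L^2([0,1])$ given by $(\mathbb{L}f)(x)=\int_0^1 w(x,y)(f(x)-f(y))\,dy$. The isolated eigenvalues of finite multiplicity of $\mathbb{L}$ are listed increasingly as $0=\lambda_1<\lambda_2<\lambda_3<\cdots$; $\lambda_2$ is the Fiedler value. Assumptions: (A1) there is $K>0$ with $|w(x,y)-w(x',y')|\le K(|x-x'|+|y-y'|)$; (A2) for every $x$, $\partial w(x,y)/\partial x$ exists and is non-zero for almost every $y$; (A3) $d'(x)$ exists for all $x\in[0,1]$ and $\{x: d'(x)=0\}$ is countable; (A4) with $\mathcal{H}=\{f\in L^2([0,1]):\int_0^1 f=0,\ \int_0^1 f^2=1\}$, $\inf_{f\in\mathcal{H}}\langle \mathbb{L}f,f\rangle<\inf_{x\in[0,1]}d(x)$. *)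

theory Defs
  imports "HOL-Analysis.Analysis"
begin

text \<open>Functions on [0,1] are represented as real-valued functions on the reals; only their
values on [0,1] matter, and elements of L2 are identified up to equality almost everywhere
on [0,1] (Lebesgue measure).\<close>

abbreviation I01 :: "real measure" where
  "I01 \<equiv> lebesgue_on {0..1}"

definition L2 :: "(real \<Rightarrow> real) set" where
  "L2 = {f. f \<in> borel_measurable I01 \<and> integrable I01 (\<lambda>x. (f x)\<^sup>2)}"

definition ae_eq :: "(real \<Rightarrow> real) \<Rightarrow> (real \<Rightarrow> real) \<Rightarrow> bool" where
  "ae_eq f g \<longleftrightarrow> (AE x in I01. f x = g x)"

definition graphon :: "(real \<Rightarrow> real \<Rightarrow> real) \<Rightarrow> bool" where
  "graphon w \<longleftrightarrow>
     set_borel_measurable borel ({0..1} \<times> {0..1}) (\<lambda>(x, y). w x y) \<and>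
     (\<forall>x\<in>{0..1}. \<forall>y\<in>{0..1}. w x y = w y x) \<and>
     (\<forall>x\<in>{0..1}. \<forall>y\<in>{0..1}. 0 \<le> w x y \<and> w x y \<le> 1)"

definition robinsonian :: "(real \<Rightarrow> real \<Rightarrow> real) \<Rightarrow> bool" where
  "robinsonian w \<longleftrightarrow>
     (\<forall>x\<in>{0..1}. \<forall>y\<in>{0..1}. \<forall>z\<in>{0..1}.
        (y < z \<and> z < x \<longrightarrow> w x y \<le> w x z) \<and>
        (x < y \<and> y < z \<longrightarrow> w x y \<ge> w x z))"

definition degree :: "(real \<Rightarrow> real \<Rightarrow> real) \<Rightarrow> real \<Rightarrow> real" where
  "degree w x = (LINT y|I01. w x y)"

definition lap :: "(real \<Rightarrow> real \<Rightarrow> real) \<Rightarrow> (real \<Rightarrow> real) \<Rightarrow> real \<Rightarrow> real" where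
  "lap w f x = (LINT y|I01. w x y * (f x - f y))"

definition inner01 :: "(real \<Rightarrow> real) \<Rightarrow> (real \<Rightarrow> real) \<Rightarrow> real" where
  "inner01 f g = (LINT x|I01. f x * g x)"

definition H_set :: "(real \<Rightarrow> real) set" where
  "H_set = {f \<in> L2. (LINT x|I01. f x) = 0 \<and> (LINT x|I01. (f x)\<^sup>2) = 1}"

definition A1 :: "(real \<Rightarrow> real \<Rightarrow> real) \<Rightarrow> bool" where
  "A1 w \<longleftrightarrow> (\<exists>K>0. \<forall>x\<in>{0..1}. \<forall>y\<in>{0..1}. \<forall>x'\<in>{0..1}. \<forall>y'\<in>{0..1}.
      \<bar>w x y - w x' y'\<bar> \<le> K * (\<bar>x - x'\<bar> + \<bar>y - y'\<bar>))"

definition A2 :: "(real \<Rightarrow> real \<Rightarrow> real) \<Rightarrow> bool" where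
  "A2 w \<longleftrightarrow> (\<forall>x\<in>{0..1}. AE y in I01.
      \<exists>D. ((\<lambda>t. w t y) has_real_derivative D) (at x within {0..1}) \<and> D \<noteq> 0)"

definition A3 :: "(real \<Rightarrow> real \<Rightarrow> real) \<Rightarrow> bool" where
  "A3 w \<longleftrightarrow> (\<forall>x\<in>{0..1}. degree w differentiable (at x within {0..1})) \<and>
     countable {x\<in>{0..1}. (degree w has_real_derivative 0) (at x within {0..1})}"

definition A4 :: "(real \<Rightarrow> real \<Rightarrow> real) \<Rightarrow> bool" where
  "A4 w \<longleftrightarrow> (INF f\<in>H_set. inner01 (lap w f) f) < (INF x\<in>{0..1}. degree w x)"

definition eigenspace :: "(real \<Rightarrow> real \<Rightarrow> real) \<Rightarrow> real \<Rightarrow> (real \<Rightarrow> real) set" where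
  "eigenspace w lam = {f \<in> L2. ae_eq (lap w f) (\<lambda>x. lam * f x)}"

definition is_eigenvalue :: "(real \<Rightarrow> real \<Rightarrow> real) \<Rightarrow> real \<Rightarrow> bool" where
  "is_eigenvalue w lam \<longleftrightarrow> (\<exists>f\<in>eigenspace w lam. \<not> ae_eq f (\<lambda>_. 0))"

definition finite_multiplicity :: "(real \<Rightarrow> real \<Rightarrow> real) \<Rightarrow> real \<Rightarrow> bool" where
  "finite_multiplicity w lam \<longleftrightarrow>
     (\<exists>B. finite B \<and> (\<forall>f\<in>eigenspace w lam. \<exists>c. ae_eq f (\<lambda>x. \<Sum>g\<in>B. c g * g x)))"

definition in_resolvent :: "(real \<Rightarrow> real \<Rightarrow> real) \<Rightarrow> real \<Rightarrow> bool" where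
  "in_resolvent w lam \<longleftrightarrow>
     (\<forall>g\<in>L2. \<exists>f\<in>L2. ae_eq (\<lambda>x. lap w f x - lam * f x) g) \<and>
     (\<forall>f\<in>L2. ae_eq (\<lambda>x. lap w f x - lam * f x) (\<lambda>_. 0) \<longrightarrow> ae_eq f (\<lambda>_. 0))"

definition spectrum :: "(real \<Rightarrow> real \<Rightarrow> real) \<Rightarrow> real set" where
  "spectrum w = {lam. \<not> in_resolvent w lam}"

definition discrete_eigenvalues :: "(real \<Rightarrow> real \<Rightarrow> real) \<Rightarrow> real set" where
  "discrete_eigenvalues w = {lam. is_eigenvalue w lam \<and> finite_multiplicity w lam \<and>
      (\<exists>e>0. spectrum w \<inter> ball lam e = {lam})}"

definition fiedler_value :: "(real \<Rightarrow> real \<Rightarrow> real) \<Rightarrow> real \<Rightarrow> bool" where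
  "fiedler_value w lam \<longleftrightarrow> lam \<in> discrete_eigenvalues w \<and>
      (\<exists>!\<mu>. \<mu> \<in> discrete_eigenvalues w \<and> \<mu> < lam)"

definition one_dimensional :: "(real \<Rightarrow> real) set \<Rightarrow> bool" where
  "one_dimensional E \<longleftrightarrow>
     (\<exists>g\<in>E. \<not> ae_eq g (\<lambda>_. 0) \<and> (\<forall>f\<in>E. \<exists>c. ae_eq f (\<lambda>x. c * g x)))"

end

theory Submission
  imports Defs "HOL-Complex_Analysis.Great_Picard"
begin

text \<open>
  Let \<open>mu\<close> be the infimum of the Rayleigh quotient over mean-zero functions. Below the minimal degree
  the Laplacian, multiplication by the degree minus a compact operator, has discrete spectrum, so
  \<open>mu\<close> is attained. Let \<open>f\<close> be a mean-zero function with \<open>L f = mu f\<close>; it is Lipschitz. Comparing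
  increments, the Robinson property shows that the total variation \<open>F\<close> of \<open>f\<close> has \<open>L F - mu F\<close>
  nonincreasing. As \<open>F\<close> is nondecreasing, Chebyshev's inequality gives a Rayleigh quotient at most
  \<open>mu\<close> for \<open>F\<close> minus its mean, which is thus an eigenfunction, too. Then so are the nondecreasing
  functions \<open>F + f\<close> and \<open>F - f\<close>, up to constants. By A2, they are strictly increasing or constant,
  and minimality of the variation forces one of them to be constant: every Fiedler function is
  monotone. In a space of dimension two there would be a nonzero one with equal values at 0 and 1.
  Finally, the same compactness argument on the complement of the constants and of \<open>f\<close> gives a
  spectral gap, whence 0 and \<open>mu\<close> are the two lowest discrete eigenvalues.
\<close>

text \<open>The argument is Perron-Frobenius for the derivative. For an eigenfunction, subtracting
  the constant \<open>f x\<close> under the integral shows that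
  \<open>(degree w x' - mu) * (f x' - f x)\<close> is the integral of
  \<open>(w x' y - w x y) * (f y - f x)\<close> over y. For x < x' the Robinson property makes the
  kernel difference nonpositive for y < x and nonnegative for y > x', so formally f' solves an
  equation with a nonnegative kernel. Passing from f to its variation F means passing from f' to its
  absolute value; F + f and F - f stand for the positive and negative parts of f', one of which has
  to vanish. A2 acts as irreducibility. Two obstacles shape the details. As w is only Lipschitz,
  everything is done with finite increments; the y between x and x' have no definite sign and cost
  an error quadratic in x' - x. And the multiplier \<open>degree w x' - mu\<close> varies with the
  point: A4 keeps it positive, and where increments have to be summed it is replaced by its upper
  bound \<open>1 - mu\<close>.\<close>

lemma finite_measure_I01: "finite_measure I01"
  by (metis cbox_interval finite_measure_lebesgue_on lmeasurable_cbox)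

interpretation I01: finite_measure I01
  by (rule finite_measure_I01)

lemma measure_I01 [simp]: "measure I01 {0..1} = 1"
  by (simp add: measure_restrict_space)

lemma AE_I01_I: "(\<And>x. x \<in> {0..1} \<Longrightarrow> P x) \<Longrightarrow> AE x in I01. P x"
  by (rule AE_I2) simp

lemma continuous_measurable_I01:
  "continuous_on {0..1} f \<Longrightarrow> f \<in> borel_measurable I01" for f :: "real \<Rightarrow> real"
  by (rule continuous_imp_measurable_on_sets_lebesgue) auto

lemma continuous_integrable_I01:
  "continuous_on {0..1} f \<Longrightarrow> integrable I01 f" for f :: "real \<Rightarrow> real"
  by (rule continuous_imp_integrable_real)

lemma continuous_nonneg_integral_0:
  fixes f :: "real \<Rightarrow> real"
  assumes f: "continuous_on {0..1} f" and nn: "\<And>x. x \<in> {0..1} \<Longrightarrow> 0 \<le> f x"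
    and 0: "(LINT x|I01. f x) = 0" and x: "x \<in> {0..1}"
  shows "f x = 0"
proof -
  have "integral {0..1} f = 0"
    using 0 lebesgue_integral_eq_integral[OF continuous_integrable_I01[OF f]] by simp
  then have "(f has_integral 0) (cbox 0 1)"
    using integrable_integral[OF integrable_continuous_real[OF f]] by simp
  then show ?thesis
    using has_integral_0_cbox_imp_0[of 0 1 f x] f nn x by auto
qed

lemma continuous_AE_0:
  fixes f :: "real \<Rightarrow> real"
  assumes f: "continuous_on {0..1} f" and 0: "AE x in I01. f x = 0" and x: "x \<in> {0..1}"
  shows "f x = 0"
proof -
  have "(LINT x|I01. \<bar>f x\<bar>) = (LINT x|I01. 0)"
    by (rule integral_cong_AE) (use f 0 in \<open>auto intro!: continuous_intros continuous_measurable_I01\<close>)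
  then have "\<bar>f x\<bar> = 0"
    by (intro continuous_nonneg_integral_0[of "\<lambda>x. \<bar>f x\<bar>"]) (use f x in \<open>auto intro!: continuous_intros\<close>)
  then show ?thesis by simp
qed

lemma integrable_AE_bound:
  fixes f g :: "real \<Rightarrow> real"
  assumes "integrable I01 g" "f \<in> borel_measurable I01" "\<And>x. x \<in> {0..1} \<Longrightarrow> \<bar>f x\<bar> \<le> g x"
  shows "integrable I01 f"
  by (rule Bochner_Integration.integrable_bound[OF assms(1,2)], rule AE_I01_I)
    (use assms(3) in force)

subsection \<open>Square-integrable functions\<close>

lemma L2_measurable [measurable_dest]: "f \<in> L2 \<Longrightarrow> f \<in> borel_measurable I01"
  by (simp add: L2_def)

lemma L2_square_integrable: "f \<in> L2 \<Longrightarrow> integrable I01 (\<lambda>x. f x * f x)"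
  by (simp add: L2_def power2_eq_square)

lemma L2_mult_integrable:
  assumes "f \<in> L2" "g \<in> L2"
  shows "integrable I01 (\<lambda>x. f x * g x)"
proof (rule integrable_AE_bound)
  show "integrable I01 (\<lambda>x. f x * f x + g x * g x)"
    using assms L2_square_integrable by auto
  show "(\<lambda>x. f x * g x) \<in> borel_measurable I01"
    using assms by (auto dest: L2_measurable)
  fix x
  have "0 \<le> (\<bar>f x\<bar> - \<bar>g x\<bar>)\<^sup>2" by simp
  then have "2 * (\<bar>f x\<bar> * \<bar>g x\<bar>) \<le> f x * f x + g x * g x"
    by (simp add: power2_eq_square algebra_simps)
  moreover have "0 \<le> \<bar>f x\<bar> * \<bar>g x\<bar>" by simp
  ultimately show "\<bar>f x * g x\<bar> \<le> f x * f x + g x * g x"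
    unfolding abs_mult by linarith
qed

lemma L2_continuous: "continuous_on {0..1} f \<Longrightarrow> f \<in> L2"
  by (auto simp: L2_def intro!: continuous_intros continuous_measurable_I01 continuous_integrable_I01)

lemma L2_const [simp]: "(\<lambda>x. c) \<in> L2"
  by (rule L2_continuous) simp

lemma L2_integrable: "f \<in> L2 \<Longrightarrow> integrable I01 f"
  using L2_mult_integrable[of f "\<lambda>x. 1"] by simp

lemma L2_add:
  assumes "f \<in> L2" "g \<in> L2"
  shows "(\<lambda>x. f x + g x) \<in> L2"
proof -
  have "integrable I01 (\<lambda>x. f x * f x + 2 * (f x * g x) + g x * g x)"
    using assms L2_mult_integrable by auto
  then have "integrable I01 (\<lambda>x. (f x + g x)\<^sup>2)"
    by (simp add: power2_eq_square algebra_simps)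
  then show ?thesis
    using assms by (auto simp: L2_def)
qed

lemma L2_mult_bounded:
  assumes f: "f \<in> L2" and b: "b \<in> borel_measurable I01"
    and B: "\<And>x. x \<in> {0..1} \<Longrightarrow> \<bar>b x\<bar> \<le> B"
  shows "(\<lambda>x. b x * f x) \<in> L2"
proof -
  have "integrable I01 (\<lambda>x. (b x * f x)\<^sup>2)"
  proof (rule integrable_AE_bound)
    show "integrable I01 (\<lambda>x. B\<^sup>2 * (f x)\<^sup>2)" using f by (simp add: L2_def)
    show "(\<lambda>x. (b x * f x)\<^sup>2) \<in> borel_measurable I01" using f b by (auto dest: L2_measurable)
    show "\<bar>(b x * f x)\<^sup>2\<bar> \<le> B\<^sup>2 * (f x)\<^sup>2" if "x \<in> {0..1}" for x
      using power_mono[OF B[OF that], of 2] by (simp add: power_mult_distrib mult_right_mono)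
  qed
  then show ?thesis using f b by (auto simp: L2_def)
qed

lemma L2_scale: "f \<in> L2 \<Longrightarrow> (\<lambda>x. c * f x) \<in> L2"
  by (rule L2_mult_bounded[where B = "\<bar>c\<bar>"]) auto

lemma L2_diff:
  assumes "f \<in> L2" "g \<in> L2"
  shows "(\<lambda>x. f x - g x) \<in> L2"
  using L2_add[OF assms(1) L2_scale[OF assms(2), of "-1"]] by simp

lemma L2_mult_continuous:
  assumes "f \<in> L2" "continuous_on {0..1} b"
  shows "(\<lambda>x. b x * f x) \<in> L2"
proof -
  have "compact (b ` {0..1})"
    using assms(2) by (rule compact_continuous_image) simp
  then obtain B where "\<And>x. x \<in> {0..1} \<Longrightarrow> \<bar>b x\<bar> \<le> B"
    using bounded_real compact_imp_bounded by (metis imageI)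
  then show ?thesis using assms by (intro L2_mult_bounded continuous_measurable_I01) auto
qed

lemma inner01_cong:
  "(\<And>x. x \<in> {0..1} \<Longrightarrow> f x = f' x) \<Longrightarrow> (\<And>x. x \<in> {0..1} \<Longrightarrow> g x = g' x) \<Longrightarrow> inner01 f g = inner01 f' g'"
  unfolding inner01_def by (rule Bochner_Integration.integral_cong) auto

lemma inner01_cong_AE:
  assumes "f \<in> L2" "f' \<in> L2" "g \<in> L2" "AE x in I01. f x = f' x"
  shows "inner01 f g = inner01 f' g"
  unfolding inner01_def by (rule integral_cong_AE) (use assms in \<open>auto dest!: L2_measurable\<close>)

lemma inner01_commute: "inner01 f g = inner01 g f"
  by (simp add: inner01_def mult.commute)

lemma inner01_scale_left [simp]: "inner01 (\<lambda>x. c * f x) g = c * inner01 f g"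
  by (simp add: inner01_def mult.assoc)

lemma inner01_scale_right [simp]: "inner01 f (\<lambda>x. c * g x) = c * inner01 f g"
  by (metis inner01_commute inner01_scale_left)

lemma inner01_add_left:
  "f \<in> L2 \<Longrightarrow> g \<in> L2 \<Longrightarrow> h \<in> L2 \<Longrightarrow> inner01 (\<lambda>x. f x + g x) h = inner01 f h + inner01 g h"
  by (simp add: inner01_def distrib_right L2_mult_integrable)

lemma inner01_diff_left:
  "f \<in> L2 \<Longrightarrow> g \<in> L2 \<Longrightarrow> h \<in> L2 \<Longrightarrow> inner01 (\<lambda>x. f x - g x) h = inner01 f h - inner01 g h"
  by (simp add: inner01_def left_diff_distrib L2_mult_integrable)

lemma inner01_add_right:
  "f \<in> L2 \<Longrightarrow> g \<in> L2 \<Longrightarrow> h \<in> L2 \<Longrightarrow> inner01 h (\<lambda>x. f x + g x) = inner01 h f + inner01 h g"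
  by (simp add: inner01_def distrib_left L2_mult_integrable)

lemma inner01_diff_right:
  "f \<in> L2 \<Longrightarrow> g \<in> L2 \<Longrightarrow> h \<in> L2 \<Longrightarrow> inner01 h (\<lambda>x. f x - g x) = inner01 h f - inner01 h g"
  by (simp add: inner01_def right_diff_distrib L2_mult_integrable)

lemma inner01_self_nonneg [simp]: "0 \<le> inner01 f f"
  by (simp add: inner01_def)

lemma inner01_self_eq_0:
  assumes "f \<in> L2" "inner01 f f = 0"
  shows "AE x in I01. f x = 0"
  using integral_nonneg_eq_0_iff_AE[OF L2_square_integrable[OF assms(1)]] assms(2)
  by (simp add: inner01_def)

lemma inner01_const: "f \<in> L2 \<Longrightarrow> inner01 f (\<lambda>x. c) = c * (LINT x|I01. f x)"
  by (simp add: inner01_def L2_integrable mult.commute)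

lemma inner01_Cauchy_Schwarz:
  assumes f: "f \<in> L2" and g: "g \<in> L2"
  shows "(inner01 f g)\<^sup>2 \<le> inner01 f f * inner01 g g"
proof -
  have *: "0 \<le> a\<^sup>2 * inner01 f f - 2 * a * b * inner01 f g + b\<^sup>2 * inner01 g g" for a b
  proof -
    have "0 \<le> inner01 (\<lambda>x. a * f x - b * g x) (\<lambda>x. a * f x - b * g x)" by simp
    also have "\<dots> = a\<^sup>2 * inner01 f f - 2 * a * b * inner01 f g + b\<^sup>2 * inner01 g g"
      using f g inner01_commute[of g f]
      by (simp add: inner01_diff_left inner01_diff_right L2_scale L2_diff power2_eq_square algebra_simps)
    finally show ?thesis .
  qed
  show ?thesis
  proof (cases "inner01 g g = 0")
    case True
    have "AE x in I01. g x = 0" using inner01_self_eq_0 g True by blast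
    then have "inner01 g f = inner01 (\<lambda>x. 0) f"
      using f g by (intro inner01_cong_AE) auto
    then show ?thesis using True by (simp add: inner01_def mult.commute)
  next
    case False
    then have pos: "0 < inner01 g g" using inner01_self_nonneg[of g] by linarith
    \<comment> \<open>The quadratic form is evaluated in its minimizing direction, a = <g,g> and b =
      <f,g>.\<close>
    have "0 \<le> inner01 g g * (inner01 f f * inner01 g g - (inner01 f g)\<^sup>2)"
      using *[of "inner01 g g" "inner01 f g"] by (simp add: power2_eq_square algebra_simps)
    then show ?thesis using pos by (simp add: zero_le_mult_iff)
  qed
qed

text \<open>The parallelogram law with the square of the difference dropped. It stands in for the
  triangle inequality, so that estimates can stay with squared norms.\<close>

lemma inner01_add_self_le:
  assumes "f \<in> L2" "g \<in> L2"
  shows "inner01 (\<lambda>x. f x + g x) (\<lambda>x. f x + g x) \<le> 2 * inner01 f f + 2 * inner01 g g"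
proof -
  have "0 \<le> inner01 (\<lambda>x. f x - g x) (\<lambda>x. f x - g x)" by simp
  then show ?thesis
    using assms inner01_commute[of g f]
    by (simp add: inner01_diff_left inner01_diff_right inner01_add_left inner01_add_right L2_diff L2_add)
qed

lemma inner01_mult_bounded_le:
  assumes f: "f \<in> L2" and b: "b \<in> borel_measurable I01"
    and B: "\<And>x. x \<in> {0..1} \<Longrightarrow> \<bar>b x\<bar> \<le> B"
  shows "inner01 (\<lambda>x. b x * f x) (\<lambda>x. b x * f x) \<le> B\<^sup>2 * inner01 f f"
proof -
  have bf: "(\<lambda>x. b x * f x) \<in> L2" using assms by (rule L2_mult_bounded)
  have "inner01 (\<lambda>x. b x * f x) (\<lambda>x. b x * f x) \<le> (LINT x|I01. B\<^sup>2 * (f x * f x))"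
    unfolding inner01_def
  proof (rule integral_mono)
    show "integrable I01 (\<lambda>x. b x * f x * (b x * f x))"
      using L2_square_integrable[OF bf] .
    show "integrable I01 (\<lambda>x. B\<^sup>2 * (f x * f x))" using L2_square_integrable[OF f] by simp
    fix x assume "x \<in> space I01"
    then have "(b x)\<^sup>2 * (f x)\<^sup>2 \<le> B\<^sup>2 * (f x)\<^sup>2"
      using power_mono[OF B[of x], of 2] by (auto intro: mult_right_mono)
    then show "b x * f x * (b x * f x) \<le> B\<^sup>2 * (f x * f x)"
      by (simp add: power2_eq_square mult_ac)
  qed
  then show ?thesis by (simp add: inner01_def)
qed

lemma inner01_bounded_le:
  assumes "f \<in> borel_measurable I01" "\<And>x. x \<in> {0..1} \<Longrightarrow> \<bar>f x\<bar> \<le> B"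
  shows "inner01 f f \<le> B\<^sup>2"
  using inner01_mult_bounded_le[of "\<lambda>x. 1" f B] assms by (simp add: inner01_def[of "\<lambda>x. 1"])

text \<open>Cauchy-Schwarz against the constant 1; the total mass 1 leaves no factor.\<close>

lemma L1_le_L2:
  assumes "f \<in> L2"
  shows "(LINT x|I01. \<bar>f x\<bar>) \<le> sqrt (inner01 f f)"
proof -
  have f: "(\<lambda>x. \<bar>f x\<bar>) \<in> L2" using assms by (auto simp: L2_def)
  have "(inner01 (\<lambda>x. \<bar>f x\<bar>) (\<lambda>x. 1))\<^sup>2 \<le> inner01 (\<lambda>x. \<bar>f x\<bar>) (\<lambda>x. \<bar>f x\<bar>) * inner01 (\<lambda>x. 1) (\<lambda>x. 1)"
    using f by (intro inner01_Cauchy_Schwarz) auto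
  then have "(LINT x|I01. \<bar>f x\<bar>)\<^sup>2 \<le> inner01 f f"
    by (simp add: inner01_def)
  then show ?thesis by (rule real_le_rsqrt)
qed

lemma lipschitz_continuous:
  fixes g :: "real \<Rightarrow> real"
  assumes "\<And>x x'. x \<in> {0..1} \<Longrightarrow> x' \<in> {0..1} \<Longrightarrow> \<bar>g x - g x'\<bar> \<le> C * \<bar>x - x'\<bar>"
  shows "continuous_on {0..1} g"
proof -
  have "\<bar>C\<bar>-lipschitz_on {0..1} g"
    using assms abs_ge_self mult_right_mono
    by (intro lipschitz_onI) (auto simp: dist_real_def, smt (verit, best) mult_right_mono)
  then show ?thesis by (rule lipschitz_on_continuous_on)
qed

lemma integral_mult_le:
  assumes f: "f \<in> L2" and b: "continuous_on {0..1} b" and B: "\<And>x. x \<in> {0..1} \<Longrightarrow> \<bar>b x\<bar> \<le> B"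
  shows "\<bar>LINT y|I01. b y * f y\<bar> \<le> B * sqrt (inner01 f f)"
proof -
  have B0: "0 \<le> B" using B[of 0] by auto
  have "\<bar>LINT y|I01. b y * f y\<bar> \<le> (LINT y|I01. \<bar>b y * f y\<bar>)"
    by (rule integral_abs_bound)
  also have "\<dots> \<le> (LINT y|I01. B * \<bar>f y\<bar>)"
  proof (rule integral_mono)
    show "integrable I01 (\<lambda>y. \<bar>b y * f y\<bar>)"
      using L2_integrable[OF L2_mult_continuous[OF f b]] by simp
    show "integrable I01 (\<lambda>y. B * \<bar>f y\<bar>)"
      using L2_integrable[OF f] by simp
    show "\<bar>b y * f y\<bar> \<le> B * \<bar>f y\<bar>" if "y \<in> space I01" for y
      using B[of y] that by (simp add: abs_mult mult_right_mono)
  qed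
  also have "\<dots> \<le> B * sqrt (inner01 f f)"
    using L1_le_L2[OF f] B0 by (simp add: mult_left_mono)
  finally show ?thesis .
qed

section \<open>Limits in the quadratic mean\<close>

lemma inner01_limit:
  assumes F: "\<And>n. F n \<in> L2" and h: "h \<in> L2" and u: "u \<in> L2"
    and lim: "(\<lambda>n. inner01 (\<lambda>x. F n x - h x) (\<lambda>x. F n x - h x)) \<longlonglongrightarrow> 0"
  shows "(\<lambda>n. inner01 (F n) u) \<longlonglongrightarrow> inner01 h u"
proof -
  have "(\<lambda>n. inner01 (F n) u - inner01 h u) \<longlonglongrightarrow> 0"
  proof (rule tendsto_0_le[where K = "sqrt (inner01 u u)"])
    show "(\<lambda>n. sqrt (inner01 (\<lambda>x. F n x - h x) (\<lambda>x. F n x - h x))) \<longlonglongrightarrow> 0"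
      using tendsto_real_sqrt[OF lim] by simp
    have "\<bar>inner01 (F n) u - inner01 h u\<bar>
        \<le> sqrt (inner01 (\<lambda>x. F n x - h x) (\<lambda>x. F n x - h x)) * sqrt (inner01 u u)" for n
      using real_sqrt_le_mono[OF inner01_Cauchy_Schwarz[OF L2_diff[OF F h] u, of n]]
      by (simp add: inner01_diff_left[OF F h u] real_sqrt_mult)
    then show "\<forall>\<^sub>F n in sequentially. norm (inner01 (F n) u - inner01 h u)
        \<le> norm (sqrt (inner01 (\<lambda>x. F n x - h x) (\<lambda>x. F n x - h x))) * sqrt (inner01 u u)"
      by (auto intro!: always_eventually)
  qed
  then show ?thesis by (simp add: LIM_zero_iff)
qed

text \<open>Keeps limits of normalized sequences away from zero, just as
  \<open>inner01_limit\<close> keeps them orthogonal to a given function.\<close>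

lemma inner01_self_limit:
  assumes F: "\<And>n. F n \<in> L2" and h: "h \<in> L2" and one: "\<And>n. inner01 (F n) (F n) = c"
    and lim: "(\<lambda>n. inner01 (\<lambda>x. F n x - h x) (\<lambda>x. F n x - h x)) \<longlonglongrightarrow> 0"
  shows "inner01 h h = c"
proof -
  have "inner01 (\<lambda>x. F n x - h x) (\<lambda>x. F n x - h x) = c - 2 * inner01 (F n) h + inner01 h h" for n
    using F h one[of n] inner01_commute[of h "F n"]
    by (simp add: inner01_diff_left inner01_diff_right L2_diff)
  then have "(\<lambda>n. c - 2 * inner01 (F n) h + inner01 h h) \<longlonglongrightarrow> 0" using lim by simp
  moreover have "(\<lambda>n. c - 2 * inner01 (F n) h + inner01 h h) \<longlonglongrightarrow> c - 2 * inner01 h h + inner01 h h"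
    by (intro tendsto_intros inner01_limit[OF F h h lim])
  ultimately have "c - 2 * inner01 h h + inner01 h h = 0" by (rule LIMSEQ_unique[symmetric])
  then show ?thesis by simp
qed

lemma const_mean_0:
  assumes "\<And>x. x \<in> {0..1} \<Longrightarrow> h x = a" "(LINT x|I01. h x) = 0"
  shows "a = (0::real)"
  using Bochner_Integration.integral_cong[OF refl, of I01 h "\<lambda>x. a"] assms by simp

section \<open>Orthogonal complements\<close>

definition perp :: "(real \<Rightarrow> real) set \<Rightarrow> (real \<Rightarrow> real) set" where
  "perp U = {h \<in> L2. \<forall>u\<in>U. inner01 h u = 0}"

lemma perp_L2: "h \<in> perp U \<Longrightarrow> h \<in> L2"
  by (simp add: perp_def)

lemma perp_scale: "f \<in> perp U \<Longrightarrow> (\<lambda>x. c * f x) \<in> perp U"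
  by (auto simp: perp_def L2_scale)

lemma H_set_eq: "H_set = {f \<in> perp {\<lambda>x. 1}. inner01 f f = 1}"
  using inner01_const[of _ 1] by (auto simp: H_set_def perp_def inner01_def power2_eq_square)

subsection \<open>The adjacency operator and the shifted Laplacian\<close>

definition adj :: "(real \<Rightarrow> real \<Rightarrow> real) \<Rightarrow> (real \<Rightarrow> real) \<Rightarrow> real \<Rightarrow> real" where
  "adj w f x = (LINT y|I01. w x y * f y)"

text \<open>This is L - lam, split into a multiplication operator and an integral operator. Where
  the degree exceeds lam, the equation \<open>slap w lam f x = g x\<close> can be solved for
  \<open>f x\<close> pointwise, and regularity of f is inherited from
  \<open>adj w f\<close>.\<close>

definition slap :: "(real \<Rightarrow> real \<Rightarrow> real) \<Rightarrow> real \<Rightarrow> (real \<Rightarrow> real) \<Rightarrow> real \<Rightarrow> real" where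
  "slap w lam f x = (degree w x - lam) * f x - adj w f x"

lemma degree_eq_adj: "degree w x = adj w (\<lambda>y. 1) x"
  by (simp add: degree_def adj_def)

text \<open>A Lipschitz bound in the first argument is enough, since symmetry transfers it to the
  second.\<close>

locale lipschitz_graphon =
  fixes w :: "real \<Rightarrow> real \<Rightarrow> real" and K :: real
  assumes w_measurable: "set_borel_measurable borel ({0..1} \<times> {0..1}) (\<lambda>(x, y). w x y)"
    and w_sym: "x \<in> {0..1} \<Longrightarrow> y \<in> {0..1} \<Longrightarrow> w x y = w y x"
    and w_nonneg: "x \<in> {0..1} \<Longrightarrow> y \<in> {0..1} \<Longrightarrow> 0 \<le> w x y"
    and w_le_1: "x \<in> {0..1} \<Longrightarrow> y \<in> {0..1} \<Longrightarrow> w x y \<le> 1"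
    and K_pos: "0 < K"
    and w_lipschitz: "x \<in> {0..1} \<Longrightarrow> x' \<in> {0..1} \<Longrightarrow> y \<in> {0..1} \<Longrightarrow> \<bar>w x y - w x' y\<bar> \<le> K * \<bar>x - x'\<bar>"
begin

lemma w_continuous: "x \<in> {0..1} \<Longrightarrow> continuous_on {0..1} (w x)"
  by (rule lipschitz_continuous[where C = K]) (use w_sym w_lipschitz in auto)

lemma adj_L2: "f \<in> L2 \<Longrightarrow> x \<in> {0..1} \<Longrightarrow> (\<lambda>y. w x y * f y) \<in> L2"
  by (intro L2_mult_continuous w_continuous)

lemma adj_integrable: "f \<in> L2 \<Longrightarrow> x \<in> {0..1} \<Longrightarrow> integrable I01 (\<lambda>y. w x y * f y)"
  by (intro L2_integrable adj_L2)

lemma adj_bound: "f \<in> L2 \<Longrightarrow> x \<in> {0..1} \<Longrightarrow> \<bar>adj w f x\<bar> \<le> sqrt (inner01 f f)"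
  using integral_mult_le[of f "w x" 1] w_continuous w_nonneg w_le_1 by (auto simp: adj_def)

lemma adj_diff_eq:
  assumes "f \<in> L2" "x \<in> {0..1}" "x' \<in> {0..1}"
  shows "adj w f x - adj w f x' = (LINT y|I01. (w x y - w x' y) * f y)"
  unfolding adj_def using adj_integrable[OF assms(1)] assms
  by (simp add: left_diff_distrib)

text \<open>The constant depends on f only through its norm, so bounded sequences have
  equicontinuous images; this is where compactness comes from.\<close>

lemma adj_lipschitz:
  assumes "f \<in> L2" "x \<in> {0..1}" "x' \<in> {0..1}"
  shows "\<bar>adj w f x - adj w f x'\<bar> \<le> (K * sqrt (inner01 f f)) * \<bar>x - x'\<bar>"
  using integral_mult_le[of f "\<lambda>y. w x y - w x' y" "K * \<bar>x - x'\<bar>"] assms w_continuous w_lipschitz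
  by (simp add: adj_diff_eq continuous_on_diff mult_ac)

lemma adj_continuous: "f \<in> L2 \<Longrightarrow> continuous_on {0..1} (adj w f)"
  by (rule lipschitz_continuous, rule adj_lipschitz)

lemma degree_lipschitz:
  "x \<in> {0..1} \<Longrightarrow> x' \<in> {0..1} \<Longrightarrow> \<bar>degree w x - degree w x'\<bar> \<le> K * \<bar>x - x'\<bar>"
  using adj_lipschitz[of "\<lambda>x. 1" x x'] by (simp add: degree_eq_adj inner01_def)

lemma degree_continuous: "continuous_on {0..1} (degree w)"
  by (rule lipschitz_continuous, rule degree_lipschitz)

lemma degree_nonneg: "x \<in> {0..1} \<Longrightarrow> 0 \<le> degree w x"
  unfolding degree_def by (rule integral_nonneg_AE, rule AE_I01_I) (use w_nonneg in auto)

lemma degree_le_1: "x \<in> {0..1} \<Longrightarrow> degree w x \<le> 1"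
  using adj_bound[of "\<lambda>x. 1" x] by (simp add: degree_eq_adj inner01_def)

lemma lap_eq_slap:
  assumes "f \<in> L2" "x \<in> {0..1}"
  shows "lap w f x - lam * f x = slap w lam f x"
proof -
  have "integrable I01 (w x)" using adj_integrable[of "\<lambda>x. 1" x] assms by simp
  then have "(LINT y|I01. w x y * (f x - f y)) = (LINT y|I01. w x y) * f x - (LINT y|I01. w x y * f y)"
    using adj_integrable[OF assms] by (simp add: right_diff_distrib)
  then show ?thesis
    by (simp add: slap_def lap_def degree_def adj_def algebra_simps)
qed

lemma adj_add: "f \<in> L2 \<Longrightarrow> g \<in> L2 \<Longrightarrow> x \<in> {0..1} \<Longrightarrow> adj w (\<lambda>x. f x + g x) x = adj w f x + adj w g x"
  using adj_integrable[of f x] adj_integrable[of g x] by (simp add: adj_def distrib_left)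

lemma adj_diff: "f \<in> L2 \<Longrightarrow> g \<in> L2 \<Longrightarrow> x \<in> {0..1} \<Longrightarrow> adj w (\<lambda>x. f x - g x) x = adj w f x - adj w g x"
  using adj_integrable[of f x] adj_integrable[of g x] by (simp add: adj_def right_diff_distrib)

lemma adj_scale: "adj w (\<lambda>x. c * f x) x = c * adj w f x"
  by (simp add: adj_def mult.left_commute[of _ c])

lemma slap_add:
  "f \<in> L2 \<Longrightarrow> g \<in> L2 \<Longrightarrow> x \<in> {0..1} \<Longrightarrow> slap w lam (\<lambda>x. f x + g x) x = slap w lam f x + slap w lam g x"
  by (simp add: slap_def adj_add algebra_simps)

lemma slap_diff:
  "f \<in> L2 \<Longrightarrow> g \<in> L2 \<Longrightarrow> x \<in> {0..1} \<Longrightarrow> slap w lam (\<lambda>x. f x - g x) x = slap w lam f x - slap w lam g x"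
  by (simp add: slap_def adj_diff algebra_simps)

lemma slap_scale: "slap w lam (\<lambda>x. c * f x) x = c * slap w lam f x"
  by (simp add: slap_def adj_scale algebra_simps)

lemma slap_const: "x \<in> {0..1} \<Longrightarrow> slap w lam (\<lambda>x. c) x = - lam * c"
  using adj_scale[of c "\<lambda>x. 1" x] by (simp add: slap_def degree_eq_adj algebra_simps)

lemma slap_shift: "slap w lam f x = slap w lam' f x + (lam' - lam) * f x"
  by (simp add: slap_def algebra_simps)

lemma slap_L2: "f \<in> L2 \<Longrightarrow> slap w lam f \<in> L2"
  unfolding slap_def[abs_def]
  by (intro L2_diff L2_mult_continuous L2_continuous[OF adj_continuous] continuous_on_diff
      degree_continuous continuous_on_const)

text \<open>The multiplication part has norm at most 1 + |lam| and the integral part at most 1; the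
  factors 2 come from \<open>inner01_add_self_le\<close>. The same constant recurs below as
  C.\<close>

lemma slap_bound:
  assumes f: "f \<in> L2"
  shows "inner01 (slap w lam f) (slap w lam f) \<le> (2 * (1 + \<bar>lam\<bar>)\<^sup>2 + 2) * inner01 f f"
proof -
  have c: "continuous_on {0..1} (\<lambda>x. degree w x - lam)"
    by (intro continuous_on_diff degree_continuous continuous_on_const)
  have 1: "(\<lambda>x. (degree w x - lam) * f x) \<in> L2"
    using f c by (rule L2_mult_continuous)
  have 2: "(\<lambda>x. (-1) * adj w f x) \<in> L2"
    by (intro L2_scale L2_continuous[OF adj_continuous[OF f]])
  have "slap w lam f = (\<lambda>x. (degree w x - lam) * f x + (-1) * adj w f x)"
    by (simp add: slap_def fun_eq_iff)
  then have "inner01 (slap w lam f) (slap w lam f)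
      \<le> 2 * inner01 (\<lambda>x. (degree w x - lam) * f x) (\<lambda>x. (degree w x - lam) * f x)
        + 2 * inner01 (\<lambda>x. (-1) * adj w f x) (\<lambda>x. (-1) * adj w f x)"
    using inner01_add_self_le[OF 1 2] by simp
  also have "inner01 (\<lambda>x. (-1) * adj w f x) (\<lambda>x. (-1) * adj w f x) \<le> (sqrt (inner01 f f))\<^sup>2"
    using 2 adj_bound[OF f] by (intro inner01_bounded_le) (auto dest: L2_measurable)
  also have "inner01 (\<lambda>x. (degree w x - lam) * f x) (\<lambda>x. (degree w x - lam) * f x)
      \<le> (1 + \<bar>lam\<bar>)\<^sup>2 * inner01 f f"
  proof (rule inner01_mult_bounded_le[OF f continuous_measurable_I01[OF c]])
    show "\<bar>degree w x - lam\<bar> \<le> 1 + \<bar>lam\<bar>" if "x \<in> {0..1}" for x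
      using degree_nonneg[OF that] degree_le_1[OF that] by linarith
  qed
  finally show ?thesis by (simp add: algebra_simps)
qed

text \<open>The hypothesis speaks of Borel sets of the plane, Fubini's theorem of the product of two
  Lebesgue spaces. The identity is measurable from the latter to the former.\<close>

lemma w_measurable_pair: "(\<lambda>z. w (fst z) (snd z)) \<in> borel_measurable (I01 \<Otimes>\<^sub>M I01)"
proof -
  have id: "(\<lambda>x. x) \<in> measurable I01 borel"
    by (rule continuous_measurable_I01) simp
  have "(\<lambda>z. (fst z, snd z)) \<in> measurable (I01 \<Otimes>\<^sub>M I01) (borel \<Otimes>\<^sub>M borel)"
    by (intro measurable_Pair measurable_compose[OF measurable_fst id] measurable_compose[OF measurable_snd id])
  then have p: "(\<lambda>z. z) \<in> measurable (I01 \<Otimes>\<^sub>M I01) (borel :: (real \<times> real) measure)"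
    by (simp add: borel_prod)
  have "(\<lambda>z. indicator ({0..1} \<times> {0..1}) z *\<^sub>R (case z of (x, y) \<Rightarrow> w x y)) \<in> borel_measurable (I01 \<Otimes>\<^sub>M I01)"
    using measurable_compose[OF p w_measurable[unfolded set_borel_measurable_def]] by simp
  moreover have "(\<lambda>z. indicator ({0..1} \<times> {0..1}) z *\<^sub>R (case z of (x, y) \<Rightarrow> w x y)) \<in> borel_measurable (I01 \<Otimes>\<^sub>M I01)
      \<longleftrightarrow> ?thesis"
    by (rule measurable_cong) (auto simp: space_pair_measure indicator_def)
  ultimately show ?thesis by blast
qed

text \<open>Fubini together with the symmetry of w. Absolute integrability is reduced to a product
  of two functions in \<open>L2\<close>, |g| and \<open>adj w\<close> applied to |f|, the latter
  being continuous.\<close>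

lemma adj_symmetric:
  assumes f: "f \<in> L2" and g: "g \<in> L2"
  shows "inner01 (adj w f) g = inner01 f (adj w g)"
proof -
  interpret pair_sigma_finite I01 I01 ..
  define h where "h = (\<lambda>(x, y). w x y * f y * g x)"
  have "(\<lambda>z. w (fst z) (snd z) * f (snd z) * g (fst z)) \<in> borel_measurable (I01 \<Otimes>\<^sub>M I01)"
    by (intro borel_measurable_times w_measurable_pair
        measurable_compose[OF measurable_fst L2_measurable[OF g]]
        measurable_compose[OF measurable_snd L2_measurable[OF f]])
  then have hm: "h \<in> borel_measurable (I01 \<Otimes>\<^sub>M I01)"
    by (simp add: h_def case_prod_beta')
  have af: "(\<lambda>y. \<bar>f y\<bar>) \<in> L2" using f by (auto simp: L2_def)
  have ag: "(\<lambda>y. \<bar>g y\<bar>) \<in> L2" using g by (auto simp: L2_def)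
  have "integrable I01 (\<lambda>x. \<bar>g x\<bar> * adj w (\<lambda>y. \<bar>f y\<bar>) x)"
    by (intro L2_mult_integrable ag L2_continuous[OF adj_continuous[OF af]])
  also have "?this \<longleftrightarrow> integrable I01 (\<lambda>x. LINT y|I01. norm (h (x, y)))"
  proof (rule Bochner_Integration.integrable_cong[OF refl])
    fix x assume x: "x \<in> space I01"
    have "(LINT y|I01. norm (h (x, y))) = (LINT y|I01. (w x y * \<bar>f y\<bar>) * \<bar>g x\<bar>)"
      by (rule Bochner_Integration.integral_cong[OF refl])
        (use x w_nonneg in \<open>auto simp: h_def abs_mult\<close>)
    then show "\<bar>g x\<bar> * adj w (\<lambda>y. \<bar>f y\<bar>) x = (LINT y|I01. norm (h (x, y)))"
      by (simp add: adj_def)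
  qed
  finally have 1: "integrable I01 (\<lambda>x. LINT y|I01. norm (h (x, y)))" .
  have 2: "AE x in I01. integrable I01 (\<lambda>y. h (x, y))"
    by (rule AE_I01_I) (use adj_integrable[OF f] in \<open>auto simp: h_def\<close>)
  have "integrable (I01 \<Otimes>\<^sub>M I01) h"
    by (rule Fubini_integrable[OF hm 1 2])
  then have "(LINT y|I01. LINT x|I01. w x y * f y * g x) = (LINT x|I01. LINT y|I01. w x y * f y * g x)"
    unfolding h_def by (rule Fubini_integral)
  also have "(LINT x|I01. LINT y|I01. w x y * f y * g x) = inner01 (adj w f) g"
    by (simp add: inner01_def adj_def)
  also have "(LINT y|I01. LINT x|I01. w x y * f y * g x) = inner01 f (adj w g)"
    unfolding inner01_def
  proof (rule Bochner_Integration.integral_cong[OF refl])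
    fix y assume y: "y \<in> space I01"
    have "(LINT x|I01. w x y * f y * g x) = (LINT x|I01. f y * (w y x * g x))"
      by (rule Bochner_Integration.integral_cong[OF refl]) (use y w_sym in auto)
    then show "(LINT x|I01. w x y * f y * g x) = f y * adj w g y"
      by (simp add: adj_def)
  qed
  finally show ?thesis by simp
qed

lemma slap_symmetric:
  assumes f: "f \<in> L2" and g: "g \<in> L2"
  shows "inner01 (slap w lam f) g = inner01 f (slap w lam g)"
proof -
  have c: "continuous_on {0..1} (\<lambda>x. degree w x - lam)"
    by (intro continuous_on_diff degree_continuous continuous_on_const)
  have L: "(\<lambda>x. (degree w x - lam) * f x) \<in> L2" "(\<lambda>x. (degree w x - lam) * g x) \<in> L2"
    "adj w f \<in> L2" "adj w g \<in> L2"
    using f g c by (auto intro: L2_mult_continuous L2_continuous adj_continuous)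
  have "inner01 (\<lambda>x. (degree w x - lam) * f x) g = inner01 f (\<lambda>x. (degree w x - lam) * g x)"
    by (simp add: inner01_def mult_ac)
  then show ?thesis
    unfolding slap_def[abs_def] using L f g adj_symmetric[OF f g]
    by (simp add: inner01_diff_left inner01_diff_right)
qed

text \<open>The solution is read off from the equation itself: \<open>f = (adj f + g) / (degree - lam)\<close>, where the
  functions \<open>adj (F n)\<close> are uniformly Lipschitz, so that a subsequence of them converges uniformly.\<close>

lemma slap_compact:
  assumes m: "\<And>x. x \<in> {0..1} \<Longrightarrow> m \<le> degree w x" and lam: "lam < m"
    and F: "\<And>n. F n \<in> L2" and g: "g \<in> L2"
    and B: "\<And>n. inner01 (F n) (F n) \<le> B"
    and lim: "(\<lambda>n. inner01 (\<lambda>x. slap w lam (F n) x - g x) (\<lambda>x. slap w lam (F n) x - g x)) \<longlonglongrightarrow> 0"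
  obtains h k where "h \<in> L2" "strict_mono (k :: nat \<Rightarrow> nat)"
    "(\<lambda>n. inner01 (\<lambda>x. F (k n) x - h x) (\<lambda>x. F (k n) x - h x)) \<longlonglongrightarrow> 0"
    "\<And>x. x \<in> {0..1} \<Longrightarrow> slap w lam h x = g x"
proof -
  have sB: "sqrt (inner01 (F n) (F n)) \<le> sqrt B" for n using B by simp
  obtain G k where G: "continuous_on {0..1} G" and k: "strict_mono (k :: nat \<Rightarrow> nat)"
    and conv: "\<And>e. 0 < e \<Longrightarrow> \<exists>N. \<forall>n x. n \<ge> N \<and> x \<in> {0..1} \<longrightarrow> norm (adj w (F (k n)) x - G x) < e"
  proof (rule Arzela_Ascoli[of "{0..1::real}" "\<lambda>n. adj w (F n)" "sqrt B"])
    show "norm (adj w (F n) x) \<le> sqrt B" if "x \<in> {0..1}" for n x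
      using order_trans[OF adj_bound[OF F that] sB] by simp
    show "\<exists>d>0. \<forall>n y. y \<in> {0..1} \<and> norm (x - y) < d \<longrightarrow> norm (adj w (F n) x - adj w (F n) y) < e"
      if x: "x \<in> {0..1}" and e: "0 < e" for x e :: real
    proof (intro exI conjI allI impI)
      \<comment> \<open>Adding 1 keeps the Lipschitz constant positive even if B = 0.\<close>
      have C: "0 < K * (\<bar>sqrt B\<bar> + 1)" using K_pos by (intro mult_pos_pos) auto
      then show "0 < e / (K * (\<bar>sqrt B\<bar> + 1))" using e by simp
      fix n y assume y: "y \<in> {0..1} \<and> norm (x - y) < e / (K * (\<bar>sqrt B\<bar> + 1))"
      have "\<bar>adj w (F n) x - adj w (F n) y\<bar> \<le> (K * sqrt (inner01 (F n) (F n))) * \<bar>x - y\<bar>"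
        using adj_lipschitz[OF F x] y by blast
      also have "\<dots> \<le> (K * (\<bar>sqrt B\<bar> + 1)) * \<bar>x - y\<bar>"
        using order_trans[OF sB[of n] abs_ge_self] K_pos
        by (intro mult_right_mono mult_left_mono) (auto simp del: real_sqrt_le_iff)
      also have "\<dots> < (K * (\<bar>sqrt B\<bar> + 1)) * (e / (K * (\<bar>sqrt B\<bar> + 1)))"
        using C y by (intro mult_strict_left_mono) auto
      also have "\<dots> = e" using C K_pos by simp
      finally show "norm (adj w (F n) x - adj w (F n) y) < e" by simp
    qed
  qed auto
  have pos: "m - lam \<le> degree w x - lam" "0 < degree w x - lam" if "x \<in> {0..1}" for x
    using m[OF that] lam by auto
  have ci: "continuous_on {0..1} (\<lambda>x. inverse (degree w x - lam))"
    using pos by (intro continuous_on_inverse continuous_on_diff degree_continuous continuous_on_const) force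
  have ib: "\<bar>inverse (degree w x - lam)\<bar> \<le> inverse (m - lam)" if "x \<in> {0..1}" for x
    using pos[OF that] lam by (simp add: le_imp_inverse_le)
  define h where "h = (\<lambda>x. inverse (degree w x - lam) * (G x + g x))"
  have h: "h \<in> L2"
    unfolding h_def by (intro L2_mult_continuous[OF _ ci] L2_add L2_continuous[OF G] g)
  let ?r = "\<lambda>n x. slap w lam (F n) x - g x"
  let ?a = "\<lambda>n x. adj w (F n) x - G x"
  have r: "?r n \<in> L2" for n by (intro L2_diff slap_L2 F g)
  have a: "?a n \<in> L2" for n by (intro L2_diff L2_continuous[OF G] L2_continuous[OF adj_continuous[OF F]])
  have lima: "(\<lambda>n. inner01 (?a (k n)) (?a (k n))) \<longlonglongrightarrow> 0"
  proof (rule LIMSEQ_I)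
    fix e :: real assume e: "0 < e"
    then have "0 < sqrt (e / 2)" by simp
    from conv[OF this] obtain N where N: "\<And>n x. n \<ge> N \<Longrightarrow> x \<in> {0..1} \<Longrightarrow> norm (?a (k n) x) < sqrt (e / 2)"
      by blast
    have "norm (inner01 (?a (k n)) (?a (k n)) - 0) < e" if "n \<ge> N" for n
    proof -
      have "inner01 (?a (k n)) (?a (k n)) \<le> (sqrt (e / 2))\<^sup>2"
        using N[OF that] by (intro inner01_bounded_le L2_measurable[OF a]) force
      then show ?thesis using e by (simp del: real_sqrt_divide)
    qed
    then show "\<exists>N. \<forall>n\<ge>N. norm (inner01 (?a (k n)) (?a (k n)) - 0) < e" by blast
  qed
  have limr: "(\<lambda>n. inner01 (?r (k n)) (?r (k n))) \<longlonglongrightarrow> 0"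
    using LIMSEQ_subseq_LIMSEQ[OF lim k] by (simp add: o_def)
  have bnd: "inner01 (\<lambda>x. F n x - h x) (\<lambda>x. F n x - h x)
      \<le> (inverse (m - lam))\<^sup>2 * (2 * inner01 (?a n) (?a n) + 2 * inner01 (?r n) (?r n))" for n
  proof -
    have "F n x - h x = inverse (degree w x - lam) * (?a n x + ?r n x)" if "x \<in> {0..1}" for x
      using pos(2)[OF that] by (simp add: h_def slap_def field_simps)
    then have "inner01 (\<lambda>x. F n x - h x) (\<lambda>x. F n x - h x) =
        inner01 (\<lambda>x. inverse (degree w x - lam) * (?a n x + ?r n x))
          (\<lambda>x. inverse (degree w x - lam) * (?a n x + ?r n x))"
      by (intro inner01_cong)
    also have "\<dots> \<le> (inverse (m - lam))\<^sup>2 * inner01 (\<lambda>x. ?a n x + ?r n x) (\<lambda>x. ?a n x + ?r n x)"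
      by (rule inner01_mult_bounded_le[OF L2_add[OF a r] continuous_measurable_I01[OF ci] ib])
    also have "\<dots> \<le> (inverse (m - lam))\<^sup>2 * (2 * inner01 (?a n) (?a n) + 2 * inner01 (?r n) (?r n))"
      by (intro mult_left_mono inner01_add_self_le a r) auto
    finally show ?thesis .
  qed
  have limF: "(\<lambda>n. inner01 (\<lambda>x. F (k n) x - h x) (\<lambda>x. F (k n) x - h x)) \<longlonglongrightarrow> 0"
  proof (rule tendsto_sandwich[OF _ _ tendsto_const])
    have "(\<lambda>n. (inverse (m - lam))\<^sup>2 * (2 * inner01 (?a (k n)) (?a (k n)) + 2 * inner01 (?r (k n)) (?r (k n))))
        \<longlonglongrightarrow> (inverse (m - lam))\<^sup>2 * (2 * 0 + 2 * 0)"
      by (intro tendsto_intros lima limr)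
    then show "(\<lambda>n. (inverse (m - lam))\<^sup>2 * (2 * inner01 (?a (k n)) (?a (k n)) + 2 * inner01 (?r (k n)) (?r (k n))))
        \<longlonglongrightarrow> 0" by simp
  qed (use bnd in \<open>auto intro: always_eventually\<close>)
  \<comment> \<open>So far G is only a uniform limit of the functions
    \<open>adj w (F (k n))\<close>. Convergence of \<open>F (k n)\<close> to h in the quadratic mean
    identifies it with \<open>adj w h\<close> at every point, since \<open>adj_bound\<close> is a
    pointwise estimate.\<close>
  have "slap w lam h x = g x" if x: "x \<in> {0..1}" for x
  proof -
    have "(\<lambda>n. adj w (F (k n)) x - adj w h x) \<longlonglongrightarrow> 0"
    proof (rule tendsto_0_le[where K = 1])
      show "(\<lambda>n. sqrt (inner01 (\<lambda>x. F (k n) x - h x) (\<lambda>x. F (k n) x - h x))) \<longlonglongrightarrow> 0"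
        using tendsto_real_sqrt[OF limF] by simp
      show "\<forall>\<^sub>F n in sequentially. norm (adj w (F (k n)) x - adj w h x)
          \<le> norm (sqrt (inner01 (\<lambda>x. F (k n) x - h x) (\<lambda>x. F (k n) x - h x))) * 1"
        using adj_bound[OF L2_diff[OF F h] x] by (auto simp: adj_diff[OF F h x] intro!: always_eventually)
    qed
    moreover have "(\<lambda>n. adj w (F (k n)) x) \<longlonglongrightarrow> G x"
    proof (rule LIMSEQ_I)
      fix e :: real assume "0 < e"
      from conv[OF this] x show "\<exists>N. \<forall>n\<ge>N. norm (adj w (F (k n)) x - G x) < e" by blast
    qed
    ultimately have "adj w h x = G x"
      using LIMSEQ_unique[of "\<lambda>n. adj w (F (k n)) x - adj w h x" "G x - adj w h x" 0]
        tendsto_diff[OF _ tendsto_const[of "adj w h x"], of "\<lambda>n. adj w (F (k n)) x" "G x"] by auto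
    moreover have "(degree w x - lam) * h x = G x + g x"
      unfolding h_def mult.assoc[symmetric] using pos(2)[OF x] by simp
    ultimately show ?thesis by (simp add: slap_def)
  qed
  with that h k limF show thesis by blast
qed

text \<open>The eigenvalue may vary with u, and shift 0 is no restriction: eigenfunctions of L are
  eigenfunctions of every shift, so the complement of U is invariant under all of them.\<close>

definition eigenset :: "(real \<Rightarrow> real) set \<Rightarrow> bool" where
  "eigenset U \<longleftrightarrow> (\<forall>u\<in>U. u \<in> L2 \<and> (\<exists>c. \<forall>x\<in>{0..1}. slap w 0 u x = c * u x))"

lemma perp_add: "eigenset U \<Longrightarrow> f \<in> perp U \<Longrightarrow> g \<in> perp U \<Longrightarrow> (\<lambda>x. f x + g x) \<in> perp U"
  by (auto simp: perp_def eigenset_def inner01_add_left L2_add)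

lemma perp_diff: "eigenset U \<Longrightarrow> f \<in> perp U \<Longrightarrow> g \<in> perp U \<Longrightarrow> (\<lambda>x. f x - g x) \<in> perp U"
  by (auto simp: perp_def eigenset_def inner01_diff_left L2_diff)

text \<open>By symmetry the operator moves onto u, which it only multiplies by a number.\<close>

lemma perp_slap:
  assumes U: "eigenset U" and f: "f \<in> perp U"
  shows "slap w lam f \<in> perp U"
proof -
  have "inner01 (slap w lam f) u = 0" if u: "u \<in> U" for u
  proof -
    obtain c where c: "\<forall>x\<in>{0..1}. slap w 0 u x = c * u x" and uL: "u \<in> L2"
      using U u by (auto simp: eigenset_def)
    have "inner01 (slap w lam f) u = inner01 f (slap w lam u)"
      using f uL by (simp add: slap_symmetric perp_L2)
    also have "\<dots> = inner01 f (\<lambda>x. (c - lam) * u x)"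
      by (rule inner01_cong) (simp_all add: slap_shift[of lam u _ 0] c algebra_simps)
    also have "\<dots> = 0" using f u by (simp add: perp_def)
    finally show ?thesis .
  qed
  then show ?thesis using f by (simp add: perp_def slap_L2)
qed

text \<open>Cauchy-Schwarz yields the square root of the constant in \<open>slap_bound\<close>. As
  that constant is at least 1, it may be used itself, and one C serves both estimates.\<close>

lemma slap_form_le:
  assumes f: "f \<in> L2"
  shows "inner01 (slap w lam f) f \<le> (2 * (1 + \<bar>lam\<bar>)\<^sup>2 + 2) * inner01 f f"
proof -
  let ?C = "2 * (1 + \<bar>lam\<bar>)\<^sup>2 + 2"
  have C: "1 \<le> ?C" using zero_le_power2[of "1 + \<bar>lam\<bar>"] by linarith
  have "(inner01 (slap w lam f) f)\<^sup>2 \<le> inner01 (slap w lam f) (slap w lam f) * inner01 f f"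
    using f by (intro inner01_Cauchy_Schwarz slap_L2)
  also have "\<dots> \<le> (?C * inner01 f f) * inner01 f f"
    by (intro mult_right_mono slap_bound f) simp
  also have "\<dots> \<le> (?C * inner01 f f) * (?C * inner01 f f)"
    using C mult_right_mono[OF C inner01_self_nonneg[of f]] by (intro mult_left_mono) auto
  finally have "(inner01 (slap w lam f) f)\<^sup>2 \<le> (?C * inner01 f f)\<^sup>2" by (simp add: power2_eq_square)
  then show ?thesis by (rule power2_le_imp_le) (use C in \<open>auto intro!: mult_nonneg_nonneg\<close>)
qed

text \<open>Positivity of the form at \<open>f - slap f / C\<close>.\<close>

lemma slap_norm_le_form:
  assumes U: "eigenset U" and psd: "\<And>h. h \<in> perp U \<Longrightarrow> 0 \<le> inner01 (slap w lam h) h"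
    and f: "f \<in> perp U"
  shows "inner01 (slap w lam f) (slap w lam f) \<le> (2 * (1 + \<bar>lam\<bar>)\<^sup>2 + 2) * inner01 (slap w lam f) f"
proof -
  define C where "C = 2 * (1 + \<bar>lam\<bar>)\<^sup>2 + 2"
  have C: "0 < C" unfolding C_def using zero_le_power2[of "1 + \<bar>lam\<bar>"] by linarith
  define g where "g = slap w lam f"
  define h where "h = (\<lambda>x. f x - (1 / C) * g x)"
  have g: "g \<in> perp U" unfolding g_def by (rule perp_slap[OF U f])
  have hp: "h \<in> perp U" unfolding h_def by (intro perp_diff perp_scale U f g)
  note L = perp_L2[OF f] perp_L2[OF g] slap_L2[OF perp_L2[OF f], of lam] slap_L2[OF perp_L2[OF g], of lam]
  have "inner01 (slap w lam h) h = inner01 (\<lambda>x. g x - (1 / C) * slap w lam g x) h"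
    unfolding h_def
  proof (rule inner01_cong)
    show "slap w lam (\<lambda>x. f x - (1 / C) * g x) x = g x - (1 / C) * slap w lam g x" if "x \<in> {0..1}" for x
      unfolding slap_diff[OF L(1) L2_scale[OF L(2)] that] slap_scale by (simp add: g_def)
  qed simp
  also have "\<dots> = inner01 g f - (2 / C) * inner01 g g + (1 / C)\<^sup>2 * inner01 (slap w lam g) g"
  proof -
    have "inner01 (slap w lam g) f = inner01 g g"
      using L by (simp add: slap_symmetric flip: g_def)
    then show ?thesis
      unfolding h_def using L
      by (simp only: inner01_diff_left inner01_diff_right L2_diff L2_scale inner01_scale_left inner01_scale_right)
        (simp add: algebra_simps power2_eq_square)
  qed
  \<comment> \<open>One of the two terms \<open>(1 / C) * inner01 g g\<close> is spent on the
    quadratic remainder; the other one is the gain.\<close>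
  also have "\<dots> \<le> inner01 g f - (2 / C) * inner01 g g + (1 / C)\<^sup>2 * (C * inner01 g g)"
    using slap_form_le[OF perp_L2[OF g], of lam] by (intro add_left_mono mult_left_mono) (auto simp: C_def)
  also have "\<dots> = inner01 g f - (1 / C) * inner01 g g"
    using C by (simp add: power2_eq_square field_simps)
  finally have "(1 / C) * inner01 g g \<le> inner01 g f" using psd[OF hp] by simp
  then have "inner01 g g \<le> C * inner01 g f" using C by (simp add: field_simps)
  then show ?thesis by (simp only: g_def C_def)
qed

text \<open>Along a minimizing sequence not only the form but also the residual
  \<open>slap w lam (F n)\<close> tends to zero, by \<open>slap_norm_le_form\<close>. Then
  \<open>slap_compact\<close> yields a strong limit, and norm and orthogonality survive. It is used
  on the complement of the constants to produce a Fiedler function and on that of 1 and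
  \<open>f0\<close> to produce the gap.\<close>

lemma form_minimizer:
  assumes U: "eigenset U" and psd: "\<And>h. h \<in> perp U \<Longrightarrow> 0 \<le> inner01 (slap w lam h) h"
    and m: "\<And>x. x \<in> {0..1} \<Longrightarrow> m \<le> degree w x" and lam: "lam < m"
    and inf: "\<And>e. 0 < e \<Longrightarrow> \<exists>h\<in>perp U. inner01 h h = 1 \<and> inner01 (slap w lam h) h < e"
  obtains h where "h \<in> perp U" "inner01 h h = 1" "\<And>x. x \<in> {0..1} \<Longrightarrow> slap w lam h x = 0"
proof -
  define C where "C = 2 * (1 + \<bar>lam\<bar>)\<^sup>2 + 2"
  have "\<forall>n. \<exists>h\<in>perp U. inner01 h h = 1 \<and> inner01 (slap w lam h) h < 1 / real (Suc n)"
    using inf by simp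
  then obtain F where F: "\<And>n. F n \<in> perp U" "\<And>n. inner01 (F n) (F n) = 1"
    "\<And>n. inner01 (slap w lam (F n)) (F n) < 1 / real (Suc n)"
    by metis
  have FL: "F n \<in> L2" for n using F(1) by (rule perp_L2)
  have "(\<lambda>n. inner01 (slap w lam (F n)) (slap w lam (F n))) \<longlonglongrightarrow> 0"
  proof (rule tendsto_sandwich[OF _ _ tendsto_const])
    have "(\<lambda>n. C * (1 / real (Suc n))) \<longlonglongrightarrow> C * 0"
      by (intro tendsto_intros LIMSEQ_Suc[OF lim_1_over_n])
    then show "(\<lambda>n. C * (1 / real (Suc n))) \<longlonglongrightarrow> 0" by simp
    have "inner01 (slap w lam (F n)) (slap w lam (F n)) \<le> C * (1 / real (Suc n))" for n
    proof -
      have "inner01 (slap w lam (F n)) (slap w lam (F n)) \<le> C * inner01 (slap w lam (F n)) (F n)"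
        unfolding C_def by (rule slap_norm_le_form[OF U psd F(1)])
      also have "\<dots> \<le> C * (1 / real (Suc n))"
        using F(3)[of n] by (intro mult_left_mono) (auto simp: C_def)
      finally show ?thesis .
    qed
    then show "\<forall>\<^sub>F n in sequentially. inner01 (slap w lam (F n)) (slap w lam (F n)) \<le> C * (1 / real (Suc n))"
      by (auto intro!: always_eventually)
  qed auto
  then have lim: "(\<lambda>n. inner01 (\<lambda>x. slap w lam (F n) x - 0) (\<lambda>x. slap w lam (F n) x - 0)) \<longlonglongrightarrow> 0"
    by simp
  obtain h k where h: "h \<in> L2" and k: "strict_mono (k :: nat \<Rightarrow> nat)"
    and limF: "(\<lambda>n. inner01 (\<lambda>x. F (k n) x - h x) (\<lambda>x. F (k n) x - h x)) \<longlonglongrightarrow> 0"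
    and sol: "\<And>x. x \<in> {0..1} \<Longrightarrow> slap w lam h x = 0"
    by (rule slap_compact[OF m lam FL L2_const _ lim, of 1]) (use F(2) in auto)
  have "inner01 h u = 0" if "u \<in> U" for u
  proof -
    have "(\<lambda>n. inner01 (F (k n)) u) \<longlonglongrightarrow> inner01 h u"
      using U that by (intro inner01_limit[OF FL h _ limF]) (auto simp: eigenset_def)
    moreover have "inner01 (F (k n)) u = 0" for n using F(1) that by (auto simp: perp_def)
    ultimately show ?thesis using LIMSEQ_unique[OF _ tendsto_const] by fastforce
  qed
  then have "h \<in> perp U" using h by (simp add: perp_def)
  moreover have "inner01 h h = 1"
    by (rule inner01_self_limit[OF FL h F(2) limF])
  ultimately show thesis using that sol by blast
qed

end

subsection \<open>Monotone majorants of the oscillation\<close>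

text \<open>Equivalently, both G + f and G - f are nondecreasing on [0,1]; in particular G itself
  is.\<close>

definition majorant :: "(real \<Rightarrow> real) \<Rightarrow> (real \<Rightarrow> real) \<Rightarrow> bool" where
  "majorant f G \<longleftrightarrow> (\<forall>x y. 0 \<le> x \<longrightarrow> x \<le> y \<longrightarrow> y \<le> 1 \<longrightarrow> \<bar>f y - f x\<bar> \<le> G y - G x)"

text \<open>The total variation of \<open>f\<close> on \<open>[0,x]\<close>, obtained as the least majorant instead of as a
  supremum over partitions.\<close>

definition variation :: "(real \<Rightarrow> real) \<Rightarrow> real \<Rightarrow> real" where
  "variation f x = (INF G\<in>Collect (majorant f). G x - G 0)"

lemma majorantD: "majorant f G \<Longrightarrow> 0 \<le> x \<Longrightarrow> x \<le> y \<Longrightarrow> y \<le> 1 \<Longrightarrow> \<bar>f y - f x\<bar> \<le> G y - G x"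
  by (simp add: majorant_def)

lemma variation_le_majorant:
  assumes "majorant f G" "0 \<le> x" "x \<le> 1"
  shows "variation f x \<le> G x - G 0"
  unfolding variation_def
proof (rule cINF_lower)
  show "bdd_below ((\<lambda>G. G x - G 0) ` Collect (majorant f))"
  proof (rule bdd_belowI2[where m = 0])
    fix H assume "H \<in> Collect (majorant f)"
    then show "0 \<le> H x - H 0" using majorantD[of f H 0 x] assms by fastforce
  qed
qed (use assms in simp)

text \<open>The required inequality holds for each majorant and passes to the infimum;
  \<open>G0\<close> keeps that infimum from being taken over the empty set.\<close>

lemma majorant_variation:
  assumes "majorant f G0"
  shows "majorant f (variation f)"
  unfolding majorant_def
proof (intro allI impI)
  fix x y :: real assume xy: "0 \<le> x" "x \<le> y" "y \<le> 1"
  have "\<bar>f y - f x\<bar> + variation f x \<le> variation f y"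
    unfolding variation_def[of f y]
  proof (rule cINF_greatest)
    fix G assume "G \<in> Collect (majorant f)"
    then show "\<bar>f y - f x\<bar> + variation f x \<le> G y - G 0"
      using majorantD[of f G x y] variation_le_majorant[of f G x] xy by auto
  qed (use assms in auto)
  then show "\<bar>f y - f x\<bar> \<le> variation f y - variation f x" by simp
qed

lemma variation_0: "majorant f G0 \<Longrightarrow> variation f 0 = 0"
  unfolding variation_def by (subst cINF_const[symmetric, of "Collect (majorant f)"]) auto

text \<open>The definition gives minimality only for increments starting at 0. Following the
  variation up to a and G from there on is again a majorant, which localizes minimality to
  [a,b].\<close>

lemma variation_least:
  assumes G: "majorant f G" and ab: "0 \<le> a" "a \<le> b" "b \<le> 1"
  shows "variation f b - variation f a \<le> G b - G a"
proof (cases "a = b")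
  case False
  define H where "H = (\<lambda>x. if x \<le> a then variation f x else variation f a + (G x - G a))"
  note V = majorant_variation[OF G]
  have "majorant f H"
    unfolding majorant_def
  proof (intro allI impI)
    fix x y :: real assume xy: "0 \<le> x" "x \<le> y" "y \<le> 1"
    consider "y \<le> a" | "x \<le> a" "a < y" | "a < x" by linarith
    then show "\<bar>f y - f x\<bar> \<le> H y - H x"
    proof cases
      case 1 then show ?thesis using majorantD[OF V xy] xy by (simp add: H_def)
    next
      case 2
      then have "\<bar>f y - f a\<bar> \<le> G y - G a" "\<bar>f a - f x\<bar> \<le> variation f a - variation f x"
        using majorantD[OF G, of a y] majorantD[OF V, of x a] xy ab by auto
      then show ?thesis using 2 by (simp add: H_def)
    next
      case 3 then show ?thesis using majorantD[OF G xy] xy by (simp add: H_def)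
    qed
  qed
  from variation_le_majorant[OF this, of b] show ?thesis
    using ab False variation_0[OF G] by (simp add: H_def)
qed simp

text \<open>Over N equal steps the increments of P telescope, while the N errors add up to C (y -
  x)^2 / N, which tends to 0. This takes the place of differentiating.\<close>

lemma subdivision_bound:
  fixes f P :: "real \<Rightarrow> real"
  assumes xy: "x \<le> y"
    and *: "\<And>s t. x \<le> s \<Longrightarrow> s \<le> t \<Longrightarrow> t \<le> y \<Longrightarrow> \<bar>f t - f s\<bar> \<le> P t - P s + C * (t - s)\<^sup>2"
  shows "\<bar>f y - f x\<bar> \<le> P y - P x"
proof -
  have **: "\<bar>f y - f x\<bar> \<le> P y - P x + (C * (y - x)\<^sup>2) * (1 / real (Suc n))" for n
  proof -
    define N where "N = real (Suc n)"
    have N: "0 < N" by (simp add: N_def)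
    define d where "d = (y - x) / N"
    have d: "0 \<le> d" using xy N by (simp add: d_def)
    have Nd: "N * d = y - x" using N by (simp add: d_def)
    have "\<bar>f (x + real i * d) - f x\<bar> \<le> P (x + real i * d) - P x + real i * (C * d\<^sup>2)"
      if "i \<le> Suc n" for i
      using that
    proof (induction i)
      case (Suc i)
      have "real (Suc i) * d \<le> N * d"
        using Suc.prems d by (intro mult_right_mono) (auto simp: N_def)
      then have "x + real (Suc i) * d \<le> y" using Nd by simp
      then have "\<bar>f (x + real (Suc i) * d) - f (x + real i * d)\<bar>
          \<le> P (x + real (Suc i) * d) - P (x + real i * d) + C * (x + real (Suc i) * d - (x + real i * d))\<^sup>2"
        using d by (intro *) (auto simp: distrib_right)
      also have "x + real (Suc i) * d - (x + real i * d) = d" by (simp add: algebra_simps)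
      finally show ?case using Suc by (simp add: algebra_simps)
    qed simp
    from this[of "Suc n"] have "\<bar>f y - f x\<bar> \<le> P y - P x + N * (C * d\<^sup>2)"
      using Nd by (simp add: N_def)
    also have "N * (C * d\<^sup>2) = (C * (y - x)\<^sup>2) * (1 / N)"
      using N by (simp add: d_def power2_eq_square)
    finally show ?thesis by (simp add: N_def)
  qed
  have "(\<lambda>n. P y - P x + (C * (y - x)\<^sup>2) * (1 / real (Suc n))) \<longlonglongrightarrow> P y - P x + (C * (y - x)\<^sup>2) * 0"
    by (intro tendsto_intros LIMSEQ_Suc[OF lim_1_over_n])
  then have "\<bar>f y - f x\<bar> \<le> P y - P x + (C * (y - x)\<^sup>2) * 0"
    by (rule LIMSEQ_le_const) (use ** in blast)
  then show ?thesis by simp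
qed

lemma divide_le_add_divide: "0 < M \<Longrightarrow> a \<le> M * b + d \<Longrightarrow> a / M \<le> b + d / M" for M :: real
  by (simp add: field_simps)

subsection \<open>Monotonicity of Fiedler functions\<close>

text \<open>Here \<open>psd\<close> makes mu just a lower bound of the Rayleigh quotient over
  mean-zero functions; that the bound is attained enters later, with
  \<open>fiedler_function\<close>.\<close>

locale fiedler_graphon = lipschitz_graphon +
  fixes mu m :: real
  assumes robinsonian: "robinsonian w" and A2: "A2 w"
    and m_le: "x \<in> {0..1} \<Longrightarrow> m \<le> degree w x" and mu_less: "mu < m"
    and psd: "h \<in> perp {\<lambda>x. 1} \<Longrightarrow> 0 \<le> inner01 (slap w mu h) h"
begin

section \<open>Consequences of the Robinson property and of A2\<close>

lemma eigenset_1: "eigenset {\<lambda>x. 1}"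
  by (auto simp: eigenset_def slap_const intro!: exI[of _ 0])

lemma w_antimono_left:
  assumes "0 \<le> y" "y < x" "x \<le> x'" "x' \<le> 1"
  shows "w x' y \<le> w x y"
proof (cases "x = x'")
  case False
  then have "w y x' \<le> w y x" using robinsonian assms by (auto simp: robinsonian_def)
  then show ?thesis using assms w_sym[of y x] w_sym[of y x'] by auto
qed simp

lemma w_mono_right:
  assumes "0 \<le> x" "x \<le> x'" "x' < y" "y \<le> 1"
  shows "w x y \<le> w x' y"
proof (cases "x = x'")
  case False
  then have "w y x \<le> w y x'" using robinsonian assms by (auto simp: robinsonian_def)
  then show ?thesis using assms w_sym[of y x] w_sym[of y x'] by auto
qed simp

text \<open>For y outside [x,x'] the function \<open>w t y\<close> is monotone in t between x and
  x'. Equal end values make it constant there, so its derivative at the midpoint c vanishes. A2 is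
  applied at c alone, so that there is a single exceptional null set.\<close>

lemma w_neq_AE:
  assumes "0 \<le> x" "x < x'" "x' \<le> 1"
  shows "AE y in I01. y < x \<or> x' < y \<longrightarrow> w x y \<noteq> w x' y"
proof -
  define c where "c = (x + x') / 2"
  have c: "x < c" "c < x'" "c \<in> {0..1}" "0 < c" "c < 1" using assms by (auto simp: c_def)
  have "w x y \<noteq> w x' y"
    if y: "y \<in> {0..1}" and D: "\<exists>D. ((\<lambda>t. w t y) has_real_derivative D) (at c within {0..1}) \<and> D \<noteq> 0"
      and out: "y < x \<or> x' < y" for y
  proof
    assume eq: "w x y = w x' y"
    have const: "w x y = w t y" if "t \<in> {x<..<x'}" for t
      using out
    proof
      assume "y < x"
      then have "w x' y \<le> w t y" "w t y \<le> w x y"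
        using that y assms by (auto intro: w_antimono_left)
      then show ?thesis using eq by simp
    next
      assume "x' < y"
      then have "w x y \<le> w t y" "w t y \<le> w x' y"
        using that y assms by (auto intro: w_mono_right)
      then show ?thesis using eq by simp
    qed
    have "((\<lambda>t. w t y) has_real_derivative 0) (at c)"
      by (rule has_field_derivative_transform_within_open[of "\<lambda>t. w x y" _ _ "{x<..<x'}"])
        (use c const in auto)
    moreover obtain D where "((\<lambda>t. w t y) has_real_derivative D) (at c)" "D \<noteq> 0"
      using D at_within_Icc_at[OF c(4,5)] by auto
    ultimately show False using DERIV_unique by blast
  qed
  moreover have "AE y in I01. \<exists>D. ((\<lambda>t. w t y) has_real_derivative D) (at c within {0..1}) \<and> D \<noteq> 0"
    using A2 c by (auto simp: A2_def)
  ultimately show ?thesis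
    using AE_space[of I01] by (auto elim: eventually_elim2)
qed

text \<open>Continuous representatives, for which the equation holds everywhere. Mean zero is not
  included; it follows once mu > 0 is known.\<close>

definition eigfun :: "(real \<Rightarrow> real) \<Rightarrow> bool" where
  "eigfun f \<longleftrightarrow> continuous_on {0..1} f \<and> (\<forall>x\<in>{0..1}. slap w mu f x = 0)"

lemma eigfun_L2: "eigfun f \<Longrightarrow> f \<in> L2"
  by (simp add: eigfun_def L2_continuous)

lemma eigfun_add: "eigfun f \<Longrightarrow> eigfun g \<Longrightarrow> eigfun (\<lambda>x. f x + g x)"
  by (auto simp: eigfun_def slap_add L2_continuous intro!: continuous_intros)

lemma eigfun_diff: "eigfun f \<Longrightarrow> eigfun g \<Longrightarrow> eigfun (\<lambda>x. f x - g x)"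
  by (auto simp: eigfun_def slap_diff L2_continuous intro!: continuous_intros)

lemma eigfun_scale: "eigfun f \<Longrightarrow> eigfun (\<lambda>x. c * f x)"
  by (auto simp: eigfun_def slap_scale intro!: continuous_intros)

lemma increment_continuous:
  assumes "continuous_on {0..1} f" "x \<in> {0..1}" "x' \<in> {0..1}"
  shows "continuous_on {0..1} (\<lambda>y. (w x' y - w x y) * (f y - f x))"
  using assms by (intro continuous_intros w_continuous)

text \<open>Subtracting \<open>f x\<close> under the integral changes it by \<open>f x\<close> times
  the increment of the degree, which is just what turns \<open>degree w x\<close> into
  \<open>degree w x'\<close> in the multiplier. The gain is an integrand whose second factor
  vanishes at y = x.\<close>

lemma slap_increment:
  assumes f: "continuous_on {0..1} f" and x: "x \<in> {0..1}" "x' \<in> {0..1}"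
  shows "slap w mu f x' - slap w mu f x =
    (degree w x' - mu) * (f x' - f x) - (LINT y|I01. (w x' y - w x y) * (f y - f x))"
proof -
  have L: "f \<in> L2" "(\<lambda>y. f x) \<in> L2" using f by (auto intro: L2_continuous)
  have "(LINT y|I01. (w x' y - w x y) * (f y - f x)) = adj w (\<lambda>y. f y - f x) x' - adj w (\<lambda>y. f y - f x) x"
    using adj_diff_eq[OF L2_diff[OF L] x(2,1)] by simp
  also have "\<dots> = adj w f x' - adj w f x - f x * (degree w x' - degree w x)"
    using x L adj_scale[of "f x" "\<lambda>x. 1" x] adj_scale[of "f x" "\<lambda>x. 1" x']
    by (simp add: adj_diff degree_eq_adj algebra_simps)
  finally show ?thesis by (simp add: slap_def algebra_simps)
qed

lemma eigfun_increment:
  assumes "eigfun f" "x \<in> {0..1}" "x' \<in> {0..1}"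
  shows "(degree w x' - mu) * (f x' - f x) = (LINT y|I01. (w x' y - w x y) * (f y - f x))"
  using slap_increment[of f x x'] assms by (auto simp: eigfun_def)

lemma degree_mu:
  assumes "x \<in> {0..1}"
  shows "0 < m - mu" "m - mu \<le> degree w x - mu" "0 < degree w x - mu" "degree w x - mu \<le> 1 - mu"
  using m_le[OF assms] mu_less degree_le_1[OF assms] by auto

lemma M_pos: "0 < 1 - mu"
  using degree_mu[of 0] by simp

text \<open>In the increment identity the kernel difference is already Lipschitz in the step, and
  the multiplier on the left is at least m - mu > 0.\<close>

lemma eigfun_lipschitz:
  assumes f: "eigfun f"
  obtains L where "0 \<le> L" "\<And>x x'. x \<in> {0..1} \<Longrightarrow> x' \<in> {0..1} \<Longrightarrow> \<bar>f x' - f x\<bar> \<le> L * \<bar>x' - x\<bar>"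
proof -
  have fc: "continuous_on {0..1} f" using f by (simp add: eigfun_def)
  have "compact (f ` {0..1})"
    using fc by (rule compact_continuous_image) simp
  then obtain B where B: "\<And>x. x \<in> {0..1} \<Longrightarrow> \<bar>f x\<bar> \<le> B"
    using bounded_real compact_imp_bounded by (metis imageI)
  have B0: "0 \<le> B" using B[of 0] by simp
  have "\<bar>f x' - f x\<bar> \<le> (2 * B * K / (m - mu)) * \<bar>x' - x\<bar>" if x: "x \<in> {0..1}" "x' \<in> {0..1}" for x x'
  proof -
    have fx: "continuous_on {0..1} (\<lambda>y. f y - f x)" using fc by (intro continuous_intros)
    have "\<bar>f y - f x\<bar> \<le> 2 * B" if "y \<in> {0..1}" for y using B[OF that] B[OF x(1)] by linarith
    then have "inner01 (\<lambda>y. f y - f x) (\<lambda>y. f y - f x) \<le> (2 * B)\<^sup>2"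
      by (intro inner01_bounded_le continuous_measurable_I01 fx)
    then have s: "sqrt (inner01 (\<lambda>y. f y - f x) (\<lambda>y. f y - f x)) \<le> 2 * B"
      using B0 by (intro real_le_lsqrt) auto
    have "(m - mu) * \<bar>f x' - f x\<bar> \<le> (degree w x' - mu) * \<bar>f x' - f x\<bar>"
      using degree_mu[OF x(2)] by (intro mult_right_mono) auto
    also have "\<dots> = \<bar>(degree w x' - mu) * (f x' - f x)\<bar>"
      using degree_mu[OF x(2)] by (simp add: abs_mult)
    also have "\<dots> \<le> (K * \<bar>x' - x\<bar>) * sqrt (inner01 (\<lambda>y. f y - f x) (\<lambda>y. f y - f x))"
      unfolding eigfun_increment[OF f x]
      by (rule integral_mult_le)
        (use x fx w_continuous w_lipschitz in \<open>auto intro!: continuous_intros L2_continuous\<close>)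
    also have "\<dots> \<le> (K * \<bar>x' - x\<bar>) * (2 * B)"
      using s K_pos by (intro mult_left_mono) auto
    finally show ?thesis
      using degree_mu[OF x(1)] by (simp add: field_simps)
  qed
  moreover have "0 \<le> 2 * B * K / (m - mu)" using B0 K_pos degree_mu[of 0] by auto
  ultimately show thesis using that by blast
qed

text \<open>With \<open>F\<close> the variation of \<open>f\<close>, the increments of \<open>f\<close> are bounded by those of \<open>F - slap F / (1 - mu)\<close>
  up to an error quadratic in the step. Subdivision removes the error, so this is a majorant, too,
  and minimality of \<open>F\<close> makes \<open>slap F\<close> nonincreasing.\<close>

lemma eigfun_variation_slap:
  assumes f: "eigfun f"
  shows "continuous_on {0..1} (variation f)" "majorant f (variation f)"
    and "\<And>x x'. 0 \<le> x \<Longrightarrow> x \<le> x' \<Longrightarrow> x' \<le> 1 \<Longrightarrow> slap w mu (variation f) x' \<le> slap w mu (variation f) x"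
proof -
  obtain L where L0: "0 \<le> L" and L: "\<And>x x'. x \<in> {0..1} \<Longrightarrow> x' \<in> {0..1} \<Longrightarrow> \<bar>f x' - f x\<bar> \<le> L * \<bar>x' - x\<bar>"
    using eigfun_lipschitz[OF f] by blast
  define F where "F = variation f"
  \<comment> \<open>A first majorant, without which the variation would be an infimum over the empty
    set.\<close>
  have mL: "majorant f (\<lambda>x. L * x)"
    unfolding majorant_def
  proof (intro allI impI)
    fix x y :: real assume "0 \<le> x" "x \<le> y" "y \<le> 1"
    then show "\<bar>f y - f x\<bar> \<le> L * y - L * x"
      using L[of x y] abs_of_nonneg[of "y - x"] by (simp add: right_diff_distrib)
  qed
  have mF: "majorant f F" unfolding F_def using mL by (rule majorant_variation)
  have Fmono: "F x \<le> F y" if "0 \<le> x" "x \<le> y" "y \<le> 1" for x y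
    using majorantD[OF mF that] by linarith
  have FL: "F y - F x \<le> L * (y - x)" if "0 \<le> x" "x \<le> y" "y \<le> 1" for x y
    using variation_least[OF mL that] by (simp add: F_def right_diff_distrib)
  have Fc: "continuous_on {0..1} F"
  proof (rule lipschitz_continuous[where C = L])
    fix x x' :: real assume "x \<in> {0..1}" "x' \<in> {0..1}"
    then show "\<bar>F x - F x'\<bar> \<le> L * \<bar>x - x'\<bar>"
      using FL[of x x'] FL[of x' x] Fmono[of x x'] Fmono[of x' x] by (cases "x \<le> x'") auto
  qed
  have fc: "continuous_on {0..1} f" using f by (simp add: eigfun_def)
  let ?u = "slap w mu F"
  have est: "\<bar>f x' - f x\<bar> \<le> (F x' - ?u x' / (1 - mu)) - (F x - ?u x / (1 - mu))
      + (2 * K * L / (1 - mu)) * (x' - x)\<^sup>2"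
    if x: "0 \<le> x" "x \<le> x'" "x' \<le> 1" for x x'
  proof -
    have xI: "x \<in> {0..1}" "x' \<in> {0..1}" using x by auto
    \<comment> \<open>For y between x and x' the kernel difference is at most K (x' - x), and the
      increments of f and of F from x to y are at most L (x' - x). Each of the two products may cost
      K L (x' - x)^2.\<close>
    define e where "e = 2 * K * L * (x' - x)\<^sup>2"
    \<comment> \<open>Outside [x,x'] the kernel difference and the increment of F have the same
      sign, so the right-hand product is already its own absolute value and dominates the left-hand
      one without error.\<close>
    have pw: "\<bar>(w x' y - w x y) * (f y - f x)\<bar> \<le> (w x' y - w x y) * (F y - F x) + e" if y: "y \<in> {0..1}" for y
    proof -
      have e0: "0 \<le> e" using K_pos L0 by (simp add: e_def)
      consider "y < x" | "x \<le> y" "y \<le> x'" | "x' < y" by linarith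
      then show ?thesis
      proof cases
        case 1
        then have "\<bar>f y - f x\<bar> \<le> F x - F y"
          using majorantD[OF mF, of y x] y x by (auto simp: abs_minus_commute)
        moreover have "w x' y - w x y \<le> 0" using w_antimono_left[of y x x'] 1 x y by auto
        ultimately have "\<bar>w x' y - w x y\<bar> * \<bar>f y - f x\<bar> \<le> - (w x' y - w x y) * (F x - F y)"
          by (intro mult_mono) auto
        then show ?thesis using e0 unfolding abs_mult by (simp add: algebra_simps)
      next
        case 3
        then have "\<bar>f y - f x\<bar> \<le> F y - F x"
          using majorantD[OF mF, of x y] y x by auto
        moreover have "0 \<le> w x' y - w x y" using w_mono_right[of x x' y] 3 x y by auto
        ultimately have "\<bar>w x' y - w x y\<bar> * \<bar>f y - f x\<bar> \<le> (w x' y - w x y) * (F y - F x)"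
          by (intro mult_mono) auto
        then show ?thesis using e0 unfolding abs_mult by simp
      next
        case 2
        have W: "\<bar>w x' y - w x y\<bar> \<le> K * (x' - x)" using w_lipschitz[of x' x y] xI y x by auto
        have d: "L * \<bar>y - x\<bar> \<le> L * (x' - x)" using 2 L0 by (intro mult_left_mono) auto
        have "\<bar>f y - f x\<bar> \<le> L * (x' - x)" using L[OF xI(1) y] d by linarith
        then have 1: "\<bar>w x' y - w x y\<bar> * \<bar>f y - f x\<bar> \<le> (K * (x' - x)) * (L * (x' - x))"
          using W K_pos x by (intro mult_mono) auto
        have "\<bar>F y - F x\<bar> \<le> L * (x' - x)"
          using FL[of x y] Fmono[of x y] 2 y x d by auto
        then have "\<bar>w x' y - w x y\<bar> * \<bar>F y - F x\<bar> \<le> (K * (x' - x)) * (L * (x' - x))"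
          using W K_pos x by (intro mult_mono) auto
        then have "- ((w x' y - w x y) * (F y - F x)) \<le> (K * (x' - x)) * (L * (x' - x))"
          unfolding abs_mult[symmetric] by linarith
        moreover have "e = (K * (x' - x)) * (L * (x' - x)) + (K * (x' - x)) * (L * (x' - x))"
          by (simp add: e_def power2_eq_square algebra_simps)
        ultimately show ?thesis using 1 unfolding abs_mult by linarith
      qed
    qed
    have "(degree w x' - mu) * \<bar>f x' - f x\<bar> = \<bar>(degree w x' - mu) * (f x' - f x)\<bar>"
      using degree_mu[OF xI(2)] by (simp add: abs_mult)
    also have "\<dots> \<le> (LINT y|I01. \<bar>(w x' y - w x y) * (f y - f x)\<bar>)"
      unfolding eigfun_increment[OF f xI] by (rule integral_abs_bound)
    also have "\<dots> \<le> (LINT y|I01. (w x' y - w x y) * (F y - F x) + e)"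
      using pw
      by (intro integral_mono continuous_integrable_I01 continuous_intros increment_continuous fc Fc xI) auto
    also have "\<dots> = (LINT y|I01. (w x' y - w x y) * (F y - F x)) + e"
      using continuous_integrable_I01[OF increment_continuous[OF Fc xI]] by simp
    also have "\<dots> = (degree w x' - mu) * (F x' - F x) - (?u x' - ?u x) + e"
      using slap_increment[OF Fc xI] by simp
    finally have "?u x' - ?u x - e \<le> (degree w x' - mu) * (F x' - F x - \<bar>f x' - f x\<bar>)"
      by (simp add: algebra_simps)
    \<comment> \<open>The last factor is nonnegative because F is a majorant. With a constant
      multiplier the estimate can be divided into increments of one function, as subdivision
      requires.\<close>
    also have "\<dots> \<le> (1 - mu) * (F x' - F x - \<bar>f x' - f x\<bar>)"
      using degree_mu[OF xI(2)] majorantD[OF mF x] by (intro mult_right_mono) auto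
    finally have "(?u x' - ?u x - e) / (1 - mu) \<le> F x' - F x - \<bar>f x' - f x\<bar>"
      using divide_le_add_divide[OF M_pos, of _ _ 0] by simp
    then show ?thesis
      by (simp add: e_def diff_divide_distrib)
  qed
  have mP: "majorant f (\<lambda>x. F x - ?u x / (1 - mu))"
    unfolding majorant_def
  proof (intro allI impI)
    fix x y :: real assume xy: "0 \<le> x" "x \<le> y" "y \<le> 1"
    show "\<bar>f y - f x\<bar> \<le> F y - ?u y / (1 - mu) - (F x - ?u x / (1 - mu))"
      by (rule subdivision_bound[OF xy(2)], rule est) (use xy in auto)
  qed
  show "continuous_on {0..1} (variation f)" "majorant f (variation f)"
    using Fc mF by (simp_all add: F_def)
  show "slap w mu (variation f) x' \<le> slap w mu (variation f) x" if "0 \<le> x" "x \<le> x'" "x' \<le> 1" for x x'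
    using variation_least[OF mP that] M_pos by (simp add: divide_le_cancel flip: F_def)
qed

text \<open>Chebyshev's inequality makes the form non-positive at the variation, which is therefore a
  minimizer of the Rayleigh quotient.\<close>

lemma eigfun_variation:
  assumes f: "eigfun f"
  obtains c where "eigfun (\<lambda>x. variation f x - c)" "(LINT x|I01. variation f x - c) = 0"
proof -
  define F where "F = variation f"
  have Fc: "continuous_on {0..1} F" and mF: "majorant f F"
    and anti: "\<And>x x'. 0 \<le> x \<Longrightarrow> x \<le> x' \<Longrightarrow> x' \<le> 1 \<Longrightarrow> slap w mu F x' \<le> slap w mu F x"
    unfolding F_def using eigfun_variation_slap[OF f] by auto
  have Fmono: "F x \<le> F y" if "0 \<le> x" "x \<le> y" "y \<le> 1" for x y
    using majorantD[OF mF that] by linarith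
  define c where "c = (LINT x|I01. F x)"
  define g where "g = (\<lambda>x. F x - c)"
  have gc: "continuous_on {0..1} g" unfolding g_def using Fc by (intro continuous_intros)
  have gL: "g \<in> L2" by (rule L2_continuous[OF gc])
  have Fi: "integrable I01 F" by (rule continuous_integrable_I01[OF Fc])
  have mean: "(LINT x|I01. g x) = 0"
    unfolding g_def using Fi by (simp add: c_def)
  have gp: "g \<in> perp {\<lambda>x. 1}"
    using gL inner01_const[OF gL, of 1] mean by (simp add: perp_def)
  define u where "u = slap w mu g"
  have u: "u x = slap w mu F x + mu * c" if "x \<in> {0..1}" for x
    unfolding u_def g_def using that L2_continuous[OF Fc] by (simp add: slap_diff slap_const)
  have uL: "u \<in> L2" unfolding u_def by (rule slap_L2[OF gL])
  have uc: "continuous_on {0..1} u"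
    unfolding u_def slap_def[abs_def]
    by (intro continuous_intros degree_continuous gc adj_continuous gL)
  have "F 0 \<le> c" "c \<le> F 1"
  proof -
    have "(LINT x|I01. F 0) \<le> (LINT x|I01. F x)"
      by (rule integral_mono) (use Fi Fmono in auto)
    moreover have "(LINT x|I01. F x) \<le> (LINT x|I01. F 1)"
      by (rule integral_mono) (use Fi Fmono in auto)
    ultimately show "F 0 \<le> c" "c \<le> F 1" by (simp_all add: c_def)
  qed
  \<comment> \<open>At a point z where F takes its mean, g changes sign and u - \<open>u z\<close>
    changes sign the opposite way. Chebyshev's inequality thus becomes pointwise, and subtracting
    \<open>u z\<close> does not change the integral because g has mean zero.\<close>
  then obtain z where z: "0 \<le> z" "z \<le> 1" "F z = c"
    using IVT'[of F 0 c 1] Fc by auto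
  have "(LINT x|I01. (u x - u z) * g x) \<le> (LINT x|I01. 0)"
  proof (rule integral_mono)
    show "integrable I01 (\<lambda>x. (u x - u z) * g x)"
      using uc gc by (intro continuous_integrable_I01 continuous_intros)
    fix x assume "x \<in> space I01"
    then have x: "0 \<le> x" "x \<le> 1" by auto
    show "(u x - u z) * g x \<le> 0"
    proof (cases "x \<le> z")
      case True
      then show ?thesis
        using anti[of x z] Fmono[of x z] x z by (intro mult_nonneg_nonpos) (auto simp: u g_def)
    next
      case False
      then show ?thesis
        using anti[of z x] Fmono[of z x] x z by (intro mult_nonpos_nonneg) (auto simp: u g_def)
    qed
  qed simp
  also have "(LINT x|I01. (u x - u z) * g x) = inner01 (\<lambda>x. u x - u z) g"
    by (simp add: inner01_def)
  also have "\<dots> = inner01 u g"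
    using inner01_diff_left[OF uL L2_const[of "u z"] gL] inner01_const[OF gL, of "u z"] mean
    by (simp add: inner01_commute[of "\<lambda>x. u z"])
  finally have "inner01 u g \<le> 0" by simp
  then have ug: "inner01 u g = 0" using psd[OF gp] by (simp add: u_def)
  \<comment> \<open>A zero of a nonnegative form lies in the kernel of the operator.\<close>
  have "inner01 u u \<le> (2 * (1 + \<bar>mu\<bar>)\<^sup>2 + 2) * inner01 u g"
    unfolding u_def by (rule slap_norm_le_form[OF eigenset_1 psd gp])
  then have "inner01 u u = 0" using ug inner01_self_nonneg[of u] by simp
  then have "AE x in I01. u x = 0" using uL by (intro inner01_self_eq_0)
  then have "\<forall>x\<in>{0..1}. u x = 0" using continuous_AE_0[OF uc] by blast
  then have "eigfun g" using gc by (simp add: eigfun_def u_def)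
  then show thesis using that mean unfolding g_def F_def by blast
qed

text \<open>Equal values at x and x' make the left side of the increment identity vanish. For
  nondecreasing p the integrand on the right is nonnegative, hence zero; outside [x,x'] the kernel
  difference is almost everywhere nonzero, so there \<open>p y = p x\<close>, and inside
  monotonicity gives the same.\<close>

lemma eigfun_mono_const:
  assumes p: "eigfun p" and mono: "\<And>x y. 0 \<le> x \<Longrightarrow> x \<le> y \<Longrightarrow> y \<le> 1 \<Longrightarrow> p x \<le> p y"
    and x: "0 \<le> x" "x < x'" "x' \<le> 1" and eq: "p x = p x'" and z: "z \<in> {0..1}"
  shows "p z = p x"
proof -
  have pc: "continuous_on {0..1} p" using p by (simp add: eigfun_def)
  have xI: "x \<in> {0..1}" "x' \<in> {0..1}" using x by auto
  let ?g = "\<lambda>y. (w x' y - w x y) * (p y - p x)"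
  have int0: "(LINT y|I01. ?g y) = 0"
    using eigfun_increment[OF p xI] eq by simp
  have mid: "p y = p x" if "x \<le> y" "y \<le> x'" for y
    using mono[of x y] mono[of y x'] that x eq by linarith
  have nn: "0 \<le> ?g y" if y: "y \<in> {0..1}" for y
  proof -
    consider "y < x" | "x \<le> y" "y \<le> x'" | "x' < y" by linarith
    then show ?thesis
    proof cases
      case 1 then show ?thesis
        using w_antimono_left[of y x x'] mono[of y x] x y by (intro mult_nonpos_nonpos) auto
    next
      case 2 then show ?thesis using mid[of y] by simp
    next
      case 3 then show ?thesis
        using w_mono_right[of x x' y] mono[of x y] x y by (intro mult_nonneg_nonneg) auto
    qed
  qed
  have g0: "?g y = 0" if "y \<in> {0..1}" for y
    using continuous_nonneg_integral_0[OF increment_continuous[OF pc xI] nn int0 that] by simp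
  have "AE y in I01. p y - p x = 0"
    using w_neq_AE[OF x] AE_space[of I01]
  proof eventually_elim
    case (elim y)
    show ?case
    proof (cases "x \<le> y \<and> y \<le> x'")
      case True then show ?thesis using mid[of y] by simp
    next
      case False
      then have "y < x \<or> x' < y" by linarith
      then have "w x y \<noteq> w x' y" using elim(1) by blast
      then have "w x' y - w x y \<noteq> 0" by linarith
      moreover have "?g y = 0" using elim(2) by (intro g0) simp
      ultimately show ?thesis by simp
    qed
  qed
  then have "p z - p x = 0"
    using pc z by (intro continuous_AE_0[of "\<lambda>y. p y - p x"]) (auto intro!: continuous_intros)
  then show ?thesis by simp
qed

text \<open>If \<open>p = F + f\<close> and \<open>q = F - f\<close> were both non-constant, a common increasing minorant \<open>s\<close> of their
  increments could be subtracted from the least majorant \<open>F\<close> of \<open>f\<close>.\<close>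

lemma eigfun_variation_const:
  assumes f: "eigfun f" and c: "eigfun (\<lambda>x. variation f x - c)"
  shows "(\<forall>x\<in>{0..1}. variation f x + f x = variation f 0 + f 0) \<or>
         (\<forall>x\<in>{0..1}. variation f x - f x = variation f 0 - f 0)"
proof (rule ccontr)
  assume neg: "\<not> ?thesis"
  define F where "F = variation f"
  have Fc: "continuous_on {0..1} F" and mF: "majorant f F"
    unfolding F_def using eigfun_variation_slap[OF f] by auto
  have fc: "continuous_on {0..1} f" using f by (simp add: eigfun_def)
  \<comment> \<open>The parameter e = 1 or e = -1 treats F + f and F - f together; the shift by c
    makes them eigenfunctions.\<close>
  define p where "p = (\<lambda>e x. F x - c + e * f x)"
  have pe: "eigfun (p e)" for e
    unfolding p_def F_def by (intro eigfun_add eigfun_scale f c)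
  have pc: "continuous_on {0..1} (p e)" for e
    unfolding p_def using Fc fc by (intro continuous_intros)
  have pmono: "p e x \<le> p e y" if "e \<in> {-1, 1}" "0 \<le> x" "x \<le> y" "y \<le> 1" for e x y
    using majorantD[OF mF that(2-4)] that(1) by (auto simp: p_def)
  have pstrict: "p e x < p e y" if e: "e \<in> {-1, 1}" and xy: "0 \<le> x" "x < y" "y \<le> 1" for e x y
  proof (rule ccontr)
    assume "\<not> p e x < p e y"
    then have eq: "p e x = p e y" using pmono[OF e xy(1) less_imp_le[OF xy(2)] xy(3)] by simp
    have "p e z = p e x" if "z \<in> {0..1}" for z
      by (rule eigfun_mono_const[OF pe pmono[OF e] xy eq that])
    then have "\<forall>z\<in>{0..1}. p e z = p e 0" by simp
    then show False using neg e by (auto simp: p_def F_def)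
  qed
  \<comment> \<open>A common lower bound for the increments of both functions from any x \<le> 1/2.
    It vanishes on the left half, so only y > 1/2 contributes to \<open>adj w phi\<close>; at these
    y, \<open>w x y\<close> is nondecreasing in x on the left half.\<close>
  define phi where "phi = (\<lambda>y. max 0 (min (p 1 y - p 1 (1/2)) (p (-1) y - p (-1) (1/2))))"
  have phic: "continuous_on {0..1} phi"
    unfolding phi_def using pc by (intro continuous_intros)
  have phiL: "phi \<in> L2" by (rule L2_continuous[OF phic])
  have phi0: "phi y = 0" if "0 \<le> y" "y \<le> 1/2" for y
    using pmono[of 1 y "1/2"] that by (simp add: phi_def)
  have phi_nn: "0 \<le> phi y" for y by (simp add: phi_def)
  have phi_le: "phi y \<le> p e y - p e x" if "e \<in> {-1, 1}" "0 \<le> x" "x \<le> 1/2" "x \<le> y" "y \<le> 1" for e x y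
  proof (cases "y \<le> 1/2")
    case True then show ?thesis using phi0[of y] pmono[of e x y] that by simp
  next
    case False
    then have "0 \<le> p 1 y - p 1 (1/2)" "0 \<le> p (-1) y - p (-1) (1/2)"
      using pmono[of 1 "1/2" y] pmono[of "-1" "1/2" y] that by auto
    then have "phi y \<le> p e y - p e (1/2)" using that(1) by (auto simp: phi_def)
    then show ?thesis using pmono[of e x "1/2"] that by auto
  qed
  \<comment> \<open>Suggested by the increment identity: replacing \<open>p e y - p e x\<close>
    under the integral by its lower bound phi and the multiplier by \<open>1 - mu\<close> leaves the
    increments of this function.\<close>
  let ?s = "\<lambda>x. adj w phi x / (1 - mu)"
  have s_diff: "adj w phi x' - adj w phi x = (LINT y|I01. (w x' y - w x y) * phi y)"
    if "x \<in> {0..1}" "x' \<in> {0..1}" for x x'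
    using adj_diff_eq[OF phiL that(2,1)] .
  have phi_int: "continuous_on {0..1} (\<lambda>y. (w x' y - w x y) * phi y)" if "x \<in> {0..1}" "x' \<in> {0..1}" for x x'
    using that phic by (intro continuous_intros w_continuous)
  have phi_pw: "0 \<le> (w x' y - w x y) * phi y" if x: "0 \<le> x" "x \<le> x'" "x' \<le> 1/2" and y: "y \<in> {0..1}" for x x' y
  proof (cases "y \<le> 1/2")
    case True then show ?thesis using phi0[of y] y by simp
  next
    case False then show ?thesis
      using w_mono_right[of x x' y] x y phi_nn by (intro mult_nonneg_nonneg) auto
  qed
  have s_mono: "adj w phi x \<le> adj w phi x'" if x: "0 \<le> x" "x \<le> x'" "x' \<le> 1/2" for x x'
  proof -
    have "0 \<le> (LINT y|I01. (w x' y - w x y) * phi y)"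
      by (rule integral_nonneg_AE, rule AE_I01_I) (use phi_pw[OF x] in auto)
    then show ?thesis using s_diff[of x x'] x by simp
  qed
  have s_le: "?s x' - ?s x \<le> p e x' - p e x" if e: "e \<in> {-1, 1}" and x: "0 \<le> x" "x \<le> x'" "x' \<le> 1/2" for e x x'
  proof -
    obtain L where L0: "0 \<le> L" and L: "\<And>x x'. x \<in> {0..1} \<Longrightarrow> x' \<in> {0..1} \<Longrightarrow> \<bar>p e x' - p e x\<bar> \<le> L * \<bar>x' - x\<bar>"
      using eigfun_lipschitz[OF pe] by blast
    have "\<bar>?s x' - ?s x\<bar> \<le> p e x' - p e x"
    proof (rule subdivision_bound[OF x(2)])
      fix s t assume "x \<le> s" "s \<le> t" "t \<le> x'"
      then have st: "0 \<le> s" "s \<le> t" "t \<le> 1/2" using x by auto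
      then have stI: "s \<in> {0..1}" "t \<in> {0..1}" by auto
      define d where "d = K * L * (t - s)\<^sup>2"
      have d0: "0 \<le> d" using K_pos L0 by (simp add: d_def)
      \<comment> \<open>For y \<le> t phi vanishes, and the right-hand product is nonnegative if y <
        s and at least -d in between. For y > t the kernel difference is nonnegative and phi lies
        below the increment of p.\<close>
      have pw: "(w t y - w s y) * phi y \<le> (w t y - w s y) * (p e y - p e s) + d" if y: "y \<in> {0..1}" for y
      proof -
        consider "y < s" | "s \<le> y" "y \<le> t" | "t < y" by linarith
        then show ?thesis
        proof cases
          case 1
          then have "0 \<le> (w t y - w s y) * (p e y - p e s)"
            using w_antimono_left[of y s t] pmono[OF e, of y s] st y by (intro mult_nonpos_nonpos) auto
          moreover have "phi y = 0" using 1 st y by (intro phi0) auto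
          ultimately show ?thesis using d0 by simp
        next
          case 2
          have "\<bar>w t y - w s y\<bar> \<le> K * (t - s)" using w_lipschitz[of t s y] stI y st by auto
          moreover have "\<bar>p e y - p e s\<bar> \<le> L * (t - s)"
            using L[OF stI(1) y] mult_left_mono[OF _ L0, of "\<bar>y - s\<bar>" "t - s"] 2 by auto
          ultimately have "\<bar>w t y - w s y\<bar> * \<bar>p e y - p e s\<bar> \<le> (K * (t - s)) * (L * (t - s))"
            using K_pos st by (intro mult_mono) auto
          then have "- ((w t y - w s y) * (p e y - p e s)) \<le> d"
            unfolding abs_mult[symmetric] by (simp add: d_def power2_eq_square mult_ac)
          moreover have "phi y = 0" using 2 st y by (intro phi0) auto
          ultimately show ?thesis by simp
        next
          case 3
          have "(w t y - w s y) * phi y \<le> (w t y - w s y) * (p e y - p e s)"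
            using w_mono_right[of s t y] phi_le[OF e, of s y] 3 st y by (intro mult_left_mono) auto
          then show ?thesis using d0 by simp
        qed
      qed
      have "adj w phi t - adj w phi s \<le> (LINT y|I01. (w t y - w s y) * (p e y - p e s) + d)"
        unfolding s_diff[OF stI] using pw
        by (intro integral_mono continuous_integrable_I01 phi_int stI continuous_intros
            increment_continuous pc) auto
      also have "\<dots> = (LINT y|I01. (w t y - w s y) * (p e y - p e s)) + d"
        using continuous_integrable_I01[OF increment_continuous[OF pc stI]] by simp
      also have "\<dots> = (degree w t - mu) * (p e t - p e s) + d"
        using eigfun_increment[OF pe stI] by simp
      also have "\<dots> \<le> (1 - mu) * (p e t - p e s) + d"
        using degree_mu[OF stI(2)] pmono[OF e, of s t] st by (intro add_right_mono mult_right_mono) auto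
      finally have "(adj w phi t - adj w phi s) / (1 - mu) \<le> p e t - p e s + d / (1 - mu)"
        by (rule divide_le_add_divide[OF M_pos])
      moreover have "0 \<le> (adj w phi t - adj w phi s) / (1 - mu)"
        using s_mono[OF st] M_pos by simp
      ultimately show "\<bar>?s t - ?s s\<bar> \<le> p e t - p e s + (K * L / (1 - mu)) * (t - s)\<^sup>2"
        by (simp add: d_def diff_divide_distrib)
    qed
    then show ?thesis by linarith
  qed
  \<comment> \<open>This amounts to the increments of ?s lying below those of both F + f and F - f.
    The cut-off at 1/2 stops the subtraction where that estimate ends.\<close>
  have "majorant f (\<lambda>x. F x - ?s (min x (1/2)))"
    unfolding majorant_def
  proof (intro allI impI)
    fix x y :: real assume xy: "0 \<le> x" "x \<le> y" "y \<le> 1"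
    have "?s (min y (1/2)) - ?s (min x (1/2)) \<le> p e y - p e x" if e: "e \<in> {-1, 1}" for e
    proof -
      have "?s (min y (1/2)) - ?s (min x (1/2)) \<le> p e (min y (1/2)) - p e (min x (1/2))"
        using xy by (intro s_le[OF e]) auto
      also have "\<dots> \<le> p e y - p e x"
        using pmono[OF e, of x y] pmono[OF e, of "1/2" y] pmono[OF e, of x "1/2"] pmono[OF e, of "1/2" x] xy
        by (auto simp: min_def)
      finally show ?thesis .
    qed
    from this[of 1] this[of "-1"]
    show "\<bar>f y - f x\<bar> \<le> F y - ?s (min y (1/2)) - (F x - ?s (min x (1/2)))"
      by (simp add: p_def)
  qed
  \<comment> \<open>Minimality of F leaves nothing to subtract, so \<open>adj w phi\<close> does not
    grow between 0 and 1/2. As the kernel difference is almost everywhere nonzero beyond 1/2, phi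
    must vanish, against strict monotonicity of both functions.\<close>
  from variation_least[OF this, of 0 "1/2"]
  have "adj w phi (1/2) - adj w phi 0 \<le> 0"
    using M_pos by (simp add: F_def divide_le_cancel)
  then have "(LINT y|I01. (w (1/2) y - w 0 y) * phi y) = 0"
    using s_diff[of 0 "1/2"] s_mono[of 0 "1/2"] by simp
  then have z: "(w (1/2) y - w 0 y) * phi y = 0" if "y \<in> {0..1}" for y
    by (rule continuous_nonneg_integral_0[rotated 2]) (use that phi_int[of 0 "1/2"] phi_pw[of 0 "1/2"] in auto)
  have ne: "AE y in I01. y < 0 \<or> 1/2 < y \<longrightarrow> w 0 y \<noteq> w (1/2) y"
    by (rule w_neq_AE) auto
  have "AE y in I01. phi y = 0"
    using ne AE_space[of I01]
  proof eventually_elim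
    case (elim y)
    show ?case
    proof (cases "y \<le> 1/2")
      case True then show ?thesis using phi0 elim(2) by simp
    next
      case False
      then have "w 0 y \<noteq> w (1/2) y" using elim(1) by linarith
      then have "w (1/2) y - w 0 y \<noteq> 0" by linarith
      then show ?thesis using z[of y] elim(2) by simp
    qed
  qed
  then have "phi 1 = 0" by (rule continuous_AE_0[OF phic]) simp
  moreover have "0 < phi 1"
    using pstrict[of 1 "1/2" 1] pstrict[of "-1" "1/2" 1] by (simp add: phi_def)
  ultimately show False by simp
qed

text \<open>One of F + f and F - f is constant, so F takes equal values at 0 and 1 as well; a
  majorant with no total increase leaves f no oscillation.\<close>

lemma eigfun_endpoints_eq_imp_const:
  assumes f: "eigfun f" and eq: "f 0 = f 1" and x: "x \<in> {0..1}"
  shows "f x = f 0"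
proof -
  obtain c where c: "eigfun (\<lambda>x. variation f x - c)" using eigfun_variation[OF f] by blast
  note mF = eigfun_variation_slap(2)[OF f]
  have "variation f 0 = variation f 1"
    using eigfun_variation_const[OF f c] eq by (auto dest!: bspec[of _ _ 1])
  then show ?thesis
    using majorantD[OF mF, of 0 x] majorantD[OF mF, of x 1] x by auto
qed

text \<open>A maximum principle at the endpoint 1 for the nondecreasing eigenfunction g. There L g
  is an integral of nonnegative terms and equals mu g(1), which is \<le> 0 if mu \<le> 0. Hence
  \<open>w 1 y\<close> vanishes for all y, so the degree at 1 is 0; since also mu = 0, this
  contradicts mu < m. Positivity is what separates mu from the eigenvalue 0.\<close>

lemma mu_pos:
  assumes f: "eigfun f" and nc: "\<exists>x\<in>{0..1}. f x \<noteq> f 0"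
  shows "0 < mu"
proof (rule ccontr)
  assume "\<not> 0 < mu"
  then have mu0: "mu \<le> 0" by simp
  obtain c where c: "eigfun (\<lambda>x. variation f x - c)" and mean: "(LINT x|I01. variation f x - c) = 0"
    using eigfun_variation[OF f] by blast
  define g where "g = (\<lambda>x. variation f x - c)"
  note mF = eigfun_variation_slap(2)[OF f]
  have g: "eigfun g" and mean: "(LINT x|I01. g x) = 0" using c mean by (simp_all add: g_def)
  have gc: "continuous_on {0..1} g" using g by (simp add: eigfun_def)
  have gmono: "g x \<le> g y" if "0 \<le> x" "x \<le> y" "y \<le> 1" for x y
    using majorantD[OF mF that] by (simp add: g_def)
  have gne: "g 0 < g 1"
  proof (rule ccontr)
    assume "\<not> g 0 < g 1"
    then have "variation f 1 \<le> variation f 0" by (simp add: g_def)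
    then show False using nc majorantD[OF mF, of 0] majorantD[OF mF, of _ 1] by fastforce
  qed
  have strict: "g y < g 1" if "0 \<le> y" "y < 1" for y
  proof (rule ccontr)
    assume "\<not> g y < g 1"
    then have "g y = g 1" using gmono[of y 1] that by simp
    then have "g 0 = g y"
      using that by (intro eigfun_mono_const[OF g gmono, of y 1]) auto
    then show False using gne \<open>g y = g 1\<close> by simp
  qed
  have g1: "0 \<le> g 1"
  proof (rule ccontr)
    assume "\<not> 0 \<le> g 1"
    moreover have "(LINT x|I01. g x) \<le> (LINT x|I01. g 1)"
      using gmono gc by (intro integral_mono continuous_integrable_I01) auto
    ultimately show False using mean by simp
  qed
  let ?h = "\<lambda>y. w 1 y * (g 1 - g y)"
  have "lap w g 1 - mu * g 1 = 0"
    using lap_eq_slap[OF eigfun_L2[OF g], of 1 mu] g by (simp add: eigfun_def)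
  then have "(LINT y|I01. ?h y) = mu * g 1" by (simp add: lap_def)
  also have "\<dots> \<le> 0" using mu0 g1 by (rule mult_nonpos_nonneg)
  finally have le: "(LINT y|I01. ?h y) \<le> 0" .
  have nn: "0 \<le> ?h y" if "y \<in> {0..1}" for y
    using w_nonneg[of 1 y] gmono[of y 1] that by auto
  have "0 \<le> (LINT y|I01. ?h y)"
    by (rule integral_nonneg_AE, rule AE_I01_I) (use nn in auto)
  then have 0: "(LINT y|I01. ?h y) = 0" using le by simp
  have hc: "continuous_on {0..1} ?h" using gc by (intro continuous_intros w_continuous) auto
  have w1: "w 1 y = 0" if "y \<in> {0..<1}" for y
    using continuous_nonneg_integral_0[OF hc nn 0, of y] strict[of y] that by auto
  have "w 1 y = 0" if "y \<in> {0..1}" for y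
    by (rule continuous_constant_on_closure[of "{0..<1}" "w 1"]) (use w_continuous[of 1] w1 that in auto)
  then have "degree w 1 = 0"
    unfolding degree_def by (subst Bochner_Integration.integral_cong[OF refl, of _ _ "\<lambda>y. 0"]) auto
  moreover have "mu = 0"
  proof -
    have "mu * g 1 = 0" using \<open>(LINT y|I01. ?h y) = mu * g 1\<close> 0 by simp
    moreover have "g 1 \<noteq> 0"
    proof
      assume "g 1 = 0"
      have "- g 0 = 0"
        by (rule continuous_nonneg_integral_0[of "\<lambda>y. - g y"])
          (use gc gmono[of _ 1] \<open>g 1 = 0\<close> mean in \<open>auto intro!: continuous_intros\<close>)
      then show False using gne \<open>g 1 = 0\<close> by simp
    qed
    ultimately show ?thesis by simp
  qed
  ultimately show False using m_le[of 1] mu_less by simp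
qed

end

subsection \<open>Resolvent and spectral gap\<close>

context lipschitz_graphon
begin

text \<open>Richardson iteration \<open>f \<mapsto> f + t (g - slap f)\<close>: the residuals tend to zero geometrically and
  the iterates stay bounded by coercivity, so that \<open>slap_compact\<close> applies.\<close>

lemma slap_coercive_solve:
  assumes U: "eigenset U" and c: "0 < c" and coercive: "\<And>h. h \<in> perp U \<Longrightarrow> c * inner01 h h \<le> inner01 (slap w lam h) h"
    and m: "\<And>x. x \<in> {0..1} \<Longrightarrow> m \<le> degree w x" and lam: "lam < m"
    and g: "g \<in> perp U"
  obtains h where "h \<in> L2" "\<And>x. x \<in> {0..1} \<Longrightarrow> slap w lam h x = g x"
proof -
  define C where "C = 2 * (1 + \<bar>lam\<bar>)\<^sup>2 + 2"
  have C: "0 < C" unfolding C_def using zero_le_power2[of "1 + \<bar>lam\<bar>"] by linarith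
  \<comment> \<open>One step multiplies the squared residual by at most 1 - 2tc + t^2 C. The choice
    gives tC \<le> c, so this is at most q = 1 - tc; the summand c^2 in the denominator ensures tc <
    1 and thus q \<ge> 0.\<close>
  define t where "t = c / (C + c\<^sup>2)"
  have D: "0 < C + c\<^sup>2" using C by (simp add: add_pos_nonneg)
  have t: "0 < t" "t * C \<le> c" "t * c < 1"
  proof -
    show "0 < t" using c D by (simp add: t_def)
    have "c * C \<le> c * (C + c\<^sup>2)" using c by (intro mult_left_mono) auto
    then show "t * C \<le> c" using D by (simp add: t_def pos_divide_le_eq)
    show "t * c < 1" using C D by (simp add: t_def pos_divide_less_eq power2_eq_square)
  qed
  define q where "q = 1 - t * c"
  have q: "0 \<le> q" "q < 1" using t c by (auto simp: q_def)
  define F where "F = rec_nat (\<lambda>x. 0) (\<lambda>n f x. f x + t * (g x - slap w lam f x))"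
  define r where "r = (\<lambda>n x. g x - slap w lam (F n) x)"
  have F0: "F 0 = (\<lambda>x. 0)" and FS: "F (Suc n) = (\<lambda>x. F n x + t * r n x)" for n
    by (simp_all add: F_def r_def)
  have z: "(\<lambda>x. 0) \<in> perp U" by (simp add: perp_def inner01_def)
  have Fp: "F n \<in> perp U" for n
  proof (induction n)
    case (Suc n)
    then show ?case unfolding FS r_def by (intro perp_add perp_scale perp_diff perp_slap U g)
  qed (simp add: F0 z)
  have rp: "r n \<in> perp U" for n
    unfolding r_def by (intro perp_diff perp_slap U g Fp)
  note L = perp_L2[OF Fp] perp_L2[OF rp] perp_L2[OF g]
  have rS: "r (Suc n) x = r n x - t * slap w lam (r n) x" if "x \<in> {0..1}" for n x
  proof -
    have "slap w lam (F (Suc n)) x = slap w lam (F n) x + t * slap w lam (r n) x"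
      unfolding FS by (simp add: slap_add[OF L(1) L2_scale[OF L(2)] that] slap_scale)
    then show ?thesis by (simp add: r_def)
  qed
  have dec: "inner01 (r (Suc n)) (r (Suc n)) \<le> q * inner01 (r n) (r n)" for n
  proof -
    let ?N = "inner01 (r n) (r n)" and ?s = "slap w lam (r n)"
    have sL: "?s \<in> L2" by (rule slap_L2[OF L(2)])
    have "inner01 (r (Suc n)) (r (Suc n)) = inner01 (\<lambda>x. r n x - t * ?s x) (\<lambda>x. r n x - t * ?s x)"
      by (intro inner01_cong rS)
    also have "\<dots> = ?N - 2 * t * inner01 ?s (r n) + t * (t * inner01 ?s ?s)"
      using L(2)[of n] sL inner01_commute[of "r n" ?s]
      by (simp only: inner01_diff_left inner01_diff_right L2_diff L2_scale inner01_scale_left inner01_scale_right)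
        (simp add: algebra_simps)
    also have "\<dots> \<le> ?N - 2 * t * (c * ?N) + t * (t * (C * ?N))"
      using coercive[OF rp[of n]] slap_bound[OF L(2), of lam n] t
      by (intro add_mono diff_mono mult_left_mono order_refl) (auto simp: C_def)
    also have "\<dots> = ?N - 2 * t * (c * ?N) + t * ((t * C) * ?N)" by (simp add: mult_ac)
    also have "\<dots> \<le> ?N - 2 * t * (c * ?N) + t * (c * ?N)"
      using t by (intro add_left_mono mult_left_mono mult_right_mono) auto
    also have "\<dots> = q * ?N" by (simp add: q_def algebra_simps)
    finally show ?thesis .
  qed
  have "r 0 x = g x" if "x \<in> {0..1}" for x
    using slap_const[OF that, of lam 0] by (simp add: r_def F0)
  then have r0: "inner01 (r 0) (r 0) = inner01 g g" by (intro inner01_cong)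
  have rq: "inner01 (r n) (r n) \<le> q ^ n * inner01 g g" for n
  proof (induction n)
    case (Suc n)
    have "q * inner01 (r n) (r n) \<le> q * (q ^ n * inner01 g g)"
      using q Suc by (intro mult_left_mono) auto
    then show ?case using dec[of n] by (simp add: mult_ac)
  qed (simp add: r0)
  have lim: "(\<lambda>n. inner01 (\<lambda>x. slap w lam (F n) x - g x) (\<lambda>x. slap w lam (F n) x - g x)) \<longlonglongrightarrow> 0"
  proof (rule tendsto_sandwich[OF _ _ tendsto_const])
    have "(\<lambda>n. q ^ n * inner01 g g) \<longlonglongrightarrow> 0 * inner01 g g"
      using q by (intro tendsto_mult tendsto_const LIMSEQ_power_zero) auto
    then show "(\<lambda>n. q ^ n * inner01 g g) \<longlonglongrightarrow> 0" by simp
    have "inner01 (\<lambda>x. slap w lam (F n) x - g x) (\<lambda>x. slap w lam (F n) x - g x) = inner01 (r n) (r n)" for n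
      by (simp add: inner01_def r_def algebra_simps)
    then show "\<forall>\<^sub>F n in sequentially. inner01 (\<lambda>x. slap w lam (F n) x - g x) (\<lambda>x. slap w lam (F n) x - g x)
        \<le> q ^ n * inner01 g g" using rq by (auto intro!: always_eventually)
  qed auto
  \<comment> \<open>The squared residual never exceeds that of g, so that of
    \<open>slap w lam (F n)\<close> is at most 2 + 2 = 4 times it. Coercivity and Cauchy-Schwarz
    then bound \<open>F n\<close> itself.\<close>
  have bnd: "inner01 (F n) (F n) \<le> 4 * inner01 g g / c\<^sup>2" for n
  proof -
    let ?s = "slap w lam (F n)" and ?N = "inner01 (F n) (F n)"
    have "inner01 (r n) (r n) \<le> inner01 g g"
      using order_trans[OF rq[of n] mult_right_mono[OF power_le_one inner01_self_nonneg]] q by simp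
    moreover have "inner01 ?s ?s \<le> 2 * inner01 g g + 2 * inner01 (\<lambda>x. (-1) * r n x) (\<lambda>x. (-1) * r n x)"
      using inner01_add_self_le[OF L(3) L2_scale[OF L(2)[of n], of "-1"]] by (simp add: r_def)
    moreover have "inner01 (\<lambda>x. (-1) * r n x) (\<lambda>x. (-1) * r n x) = inner01 (r n) (r n)"
      unfolding inner01_scale_left inner01_scale_right by simp
    ultimately have s: "inner01 ?s ?s \<le> 4 * inner01 g g" by linarith
    have "(c * ?N)\<^sup>2 \<le> (inner01 ?s (F n))\<^sup>2"
      using coercive[OF Fp[of n]] c by (intro power_mono) auto
    also have "\<dots> \<le> inner01 ?s ?s * ?N"
      by (intro inner01_Cauchy_Schwarz slap_L2 L)
    also have "\<dots> \<le> (4 * inner01 g g) * ?N" using s by (intro mult_right_mono) auto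
    finally have "?N * (c\<^sup>2 * ?N) \<le> ?N * (4 * inner01 g g)" by (simp add: power2_eq_square mult_ac)
    then have "c\<^sup>2 * ?N \<le> 4 * inner01 g g \<or> ?N = 0"
      using inner01_self_nonneg[of "F n"] by (metis mult_le_cancel_left_pos order_le_less)
    then show ?thesis using c by (auto simp: pos_le_divide_eq mult.commute)
  qed
  show thesis
  proof (rule slap_compact[OF m lam L(1) L(3) bnd lim])
    fix h assume "h \<in> L2" "\<And>x. x \<in> {0..1} \<Longrightarrow> slap w lam h x = g x"
    then show thesis by (rule that)
  qed
qed

section \<open>The infimum of the Rayleigh quotient\<close>

lemma normalize:
  assumes h: "h \<in> perp U" and ne: "inner01 h h \<noteq> 0"
  defines "g \<equiv> (\<lambda>x. (1 / sqrt (inner01 h h)) * h x)"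
  shows "g \<in> perp U" "inner01 g g = 1" "inner01 (slap w lam g) g = inner01 (slap w lam h) h / inner01 h h"
proof -
  have pos: "0 < inner01 h h" using ne inner01_self_nonneg[of h] by linarith
  show "g \<in> perp U" unfolding g_def by (rule perp_scale[OF h])
  have s: "(1 / sqrt (inner01 h h)) * ((1 / sqrt (inner01 h h)) * X) = X / inner01 h h" for X
    using pos by (simp add: field_simps)
  show "inner01 g g = 1"
    unfolding g_def inner01_scale_left inner01_scale_right s using pos by simp
  have "slap w lam g = (\<lambda>x. (1 / sqrt (inner01 h h)) * slap w lam h x)"
    unfolding g_def by (rule ext) (rule slap_scale)
  then show "inner01 (slap w lam g) g = inner01 (slap w lam h) h / inner01 h h"
    unfolding g_def by (simp only: inner01_scale_left inner01_scale_right s)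
qed

text \<open>Functions vanishing almost everywhere cannot be normalized and need this separate
  treatment.\<close>

lemma slap_form_null:
  assumes "h \<in> L2" "inner01 h h = 0"
  shows "inner01 (slap w lam h) h = 0"
  using inner01_Cauchy_Schwarz[OF slap_L2[OF assms(1)] assms(1), of lam] assms by simp

lemma lap_form: "f \<in> L2 \<Longrightarrow> inner01 (lap w f) f = inner01 (slap w 0 f) f"
  using lap_eq_slap[of f _ 0] by (intro inner01_cong) auto

lemma slap_form_shift:
  assumes "f \<in> L2"
  shows "inner01 (slap w lam f) f = inner01 (slap w lam' f) f + (lam' - lam) * inner01 f f"
proof -
  have "inner01 (slap w lam f) f = inner01 (\<lambda>x. slap w lam' f x + (lam' - lam) * f x) f"
    by (rule inner01_cong) (rule slap_shift, simp)
  then show ?thesis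
    using assms by (simp add: inner01_add_left slap_L2 L2_scale)
qed

text \<open>Makes the infimum over \<open>H_set\<close> meaningful; the identity minus its mean,
  normalized, is a member.\<close>

lemma H_set_nonempty: "H_set \<noteq> {}"
proof -
  define c where "c = (LINT x|I01. x)"
  define h where "h = (\<lambda>x::real. x - c)"
  have hc: "continuous_on {0..1} h" unfolding h_def by (intro continuous_intros)
  have hL: "h \<in> L2" by (rule L2_continuous[OF hc])
  have "integrable I01 (\<lambda>x. x)" by (rule continuous_integrable_I01) simp
  then have "(LINT x|I01. h x) = 0" by (simp add: h_def c_def)
  then have hp: "h \<in> perp {\<lambda>x. 1}" using hL inner01_const[OF hL, of 1] by (simp add: perp_def)
  have "inner01 h h \<noteq> 0"
  proof
    assume "inner01 h h = 0"
    then have "AE x in I01. h x = 0" by (rule inner01_self_eq_0[OF hL])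
    note h0 = continuous_AE_0[OF hc this]
    from h0[of 0] h0[of 1] show False by (simp add: h_def)
  qed
  then show ?thesis using normalize[OF hp] by (auto simp: H_set_eq)
qed

lemma lap_form_bdd_below: "bdd_below ((\<lambda>f. inner01 (lap w f) f) ` H_set)"
\<comment> \<open>At lam = 0 the constant of \<open>slap_bound\<close> is 4, so on unit vectors
  Cauchy-Schwarz bounds the form by 2.\<close>
proof (rule bdd_belowI2[where m = "-2"])
  fix f assume f: "f \<in> H_set"
  then have fL: "f \<in> L2" and 1: "inner01 f f = 1" by (auto simp: H_set_eq perp_L2)
  have "(inner01 (slap w 0 f) f)\<^sup>2 \<le> inner01 (slap w 0 f) (slap w 0 f) * inner01 f f"
    by (intro inner01_Cauchy_Schwarz slap_L2 fL)
  also have "\<dots> \<le> 2\<^sup>2" using slap_bound[OF fL, of 0] 1 by simp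
  finally have "\<bar>inner01 (slap w 0 f) f\<bar> \<le> 2" using abs_le_square_iff[of _ "2::real"] by simp
  then show "- 2 \<le> inner01 (lap w f) f" using lap_form[OF fL] by simp
qed

definition rayleigh :: real where
  "rayleigh = (INF f\<in>H_set. inner01 (lap w f) f)"

lemma rayleigh_psd:
  assumes h: "h \<in> perp {\<lambda>x. 1}"
  shows "0 \<le> inner01 (slap w rayleigh h) h"
proof (cases "inner01 h h = 0")
  case True then show ?thesis using slap_form_null[OF perp_L2[OF h]] by simp
next
  case False
  note n = normalize[OF h False]
  let ?g = "\<lambda>x. (1 / sqrt (inner01 h h)) * h x"
  have "?g \<in> H_set" using n by (simp add: H_set_eq)
  then have "rayleigh \<le> inner01 (lap w ?g) ?g"
    unfolding rayleigh_def by (rule cINF_lower[OF lap_form_bdd_below])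
  then have "0 \<le> inner01 (slap w rayleigh ?g) ?g"
    using slap_form_shift[OF perp_L2[OF n(1)], of rayleigh 0] lap_form[OF perp_L2[OF n(1)]] n(2) by simp
  moreover have "0 < inner01 h h" using False inner01_self_nonneg[of h] by linarith
  ultimately show ?thesis unfolding n(3) by (simp add: zero_le_divide_iff)
qed

lemma rayleigh_approx:
  assumes "0 < e"
  shows "\<exists>h\<in>perp {\<lambda>x. 1}. inner01 h h = 1 \<and> inner01 (slap w rayleigh h) h < e"
proof -
  have "(INF f\<in>H_set. inner01 (lap w f) f) < rayleigh + e" using assms by (simp add: rayleigh_def)
  then obtain f where f: "f \<in> H_set" "inner01 (lap w f) f < rayleigh + e"
    using cINF_less_iff[OF H_set_nonempty lap_form_bdd_below] by blast
  then have fp: "f \<in> perp {\<lambda>x. 1}" "inner01 f f = 1" by (auto simp: H_set_eq)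
  have "inner01 (slap w rayleigh f) f < e"
    using slap_form_shift[OF perp_L2[OF fp(1)], of rayleigh 0] lap_form[OF perp_L2[OF fp(1)]] f fp by simp
  then show ?thesis using fp by blast
qed

section \<open>Eigenspaces and spectrum up to null sets\<close>

lemma ae_eq_lap_iff:
  assumes "f \<in> L2"
  shows "ae_eq (\<lambda>x. lap w f x - lam * f x) g \<longleftrightarrow> (AE x in I01. slap w lam f x = g x)"
  unfolding ae_eq_def using lap_eq_slap[OF assms] by (intro AE_cong) simp

lemma eigenspace_iff:
  "f \<in> eigenspace w lam \<longleftrightarrow> f \<in> L2 \<and> (AE x in I01. slap w lam f x = 0)"
proof -
  have "ae_eq (lap w f) (\<lambda>x. lam * f x) \<longleftrightarrow> ae_eq (\<lambda>x. lap w f x - lam * f x) (\<lambda>x. 0)"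
    by (simp add: ae_eq_def)
  then show ?thesis using ae_eq_lap_iff[of f lam] by (auto simp: eigenspace_def)
qed

lemma slap_AE_0_inner:
  assumes "f \<in> L2" "AE x in I01. slap w lam f x = 0" "g \<in> L2"
  shows "inner01 (slap w lam f) g = 0"
  using inner01_cong_AE[OF slap_L2[OF assms(1)] L2_const assms(3,2)] by (simp add: inner01_def)

lemma slap_AE_0_orthogonal:
  assumes f: "f \<in> L2" "AE x in I01. slap w lam f x = 0"
    and g: "g \<in> L2" "\<And>x. x \<in> {0..1} \<Longrightarrow> slap w c g x = 0" and ne: "lam \<noteq> c"
  shows "inner01 f g = 0"
proof -
  have "0 = inner01 f (slap w lam g)"
    using slap_AE_0_inner[OF f g(1)] slap_symmetric[OF f(1) g(1)] by simp
  also have "\<dots> = inner01 f (\<lambda>x. (c - lam) * g x)"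
    by (rule inner01_cong) (use g(2) slap_shift[of lam g _ c] in auto)
  finally show ?thesis using ne by simp
qed

lemma eigenvalue_in_spectrum: "is_eigenvalue w lam \<Longrightarrow> lam \<in> spectrum w"
  using eigenspace_iff ae_eq_lap_iff
  by (fastforce simp: is_eigenvalue_def spectrum_def in_resolvent_def)

end

context fiedler_graphon
begin

lemma slap_0_imp_eigfun:
  assumes f: "f \<in> L2" and 0: "\<And>x. x \<in> {0..1} \<Longrightarrow> slap w mu f x = 0"
  shows "eigfun f"
proof -
  have "continuous_on {0..1} (\<lambda>x. adj w f x / (degree w x - mu))"
    using degree_mu(3) by (intro continuous_intros adj_continuous degree_continuous f) force
  moreover have "adj w f x / (degree w x - mu) = f x" if "x \<in> {0..1}" for x
    using 0[OF that] degree_mu(3)[OF that] by (simp add: slap_def field_simps)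
  ultimately have "continuous_on {0..1} f" by (rule continuous_on_eq)
  then show ?thesis using 0 by (simp add: eigfun_def)
qed

text \<open>Solving the equation for f expresses it almost everywhere as a quotient of continuous
  functions. Since \<open>adj\<close> ignores null sets, this quotient satisfies the equation at
  every point.\<close>

lemma slap_AE_0_representative:
  assumes f: "f \<in> L2" and 0: "AE x in I01. slap w mu f x = 0"
  obtains g where "eigfun g" "AE x in I01. f x = g x"
proof -
  define g where "g = (\<lambda>x. adj w f x / (degree w x - mu))"
  have gc: "continuous_on {0..1} g"
    unfolding g_def using degree_mu(3) by (intro continuous_intros adj_continuous degree_continuous f) force
  have eq: "AE x in I01. f x = g x"
    using 0 AE_space[of I01]
  proof eventually_elim
    case (elim x)
    then show ?case using degree_mu(3)[of x] by (simp add: slap_def g_def field_simps)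
  qed
  have "slap w mu g x = 0" if x: "x \<in> {0..1}" for x
  proof -
    have "adj w g x = adj w f x"
      unfolding adj_def
      by (rule integral_cong_AE)
        (use eq adj_L2[OF f x] adj_L2[OF L2_continuous[OF gc] x] in \<open>auto dest!: L2_measurable\<close>)
    then show ?thesis using degree_mu(3)[OF x] by (simp add: slap_def g_def)
  qed
  then have "eigfun g" using gc by (simp add: eigfun_def)
  then show thesis using that eq by blast
qed

end

section \<open>Simplicity of mu and the bottom of the spectrum\<close>

locale fiedler_function = fiedler_graphon +
  fixes f0 :: "real \<Rightarrow> real"
  assumes f0: "eigfun f0" "inner01 f0 (\<lambda>x. 1) = 0" "inner01 f0 f0 = 1"
begin

lemma f0_L2: "f0 \<in> L2"
  using f0(1) by (rule eigfun_L2)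

lemma f0_mean: "(LINT x|I01. f0 x) = 0"
  using f0(2) inner01_const[OF f0_L2, of 1] by simp

lemma f0_nonconst: "\<exists>x\<in>{0..1}. f0 x \<noteq> f0 0"
proof (rule ccontr)
  assume "\<not> ?thesis"
  then have c: "\<And>x. x \<in> {0..1} \<Longrightarrow> f0 x = f0 0" by blast
  have "f0 0 = 0" by (rule const_mean_0[OF c f0_mean])
  then have "f0 x = 0" if "x \<in> {0..1}" for x using c[OF that] by simp
  then have "inner01 f0 f0 = inner01 (\<lambda>x. 0) (\<lambda>x. 0)" by (intro inner01_cong)
  then show False using f0(3) by (simp add: inner01_def)
qed

lemma mu_positive: "0 < mu"
  using mu_pos[OF f0(1) f0_nonconst] .

lemma f0_endpoints: "f0 0 \<noteq> f0 1"
  using eigfun_endpoints_eq_imp_const[OF f0(1)] f0_nonconst by blast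

text \<open>Constants are eigenfunctions for 0, and mu is not 0.\<close>

lemma eigfun_mean:
  assumes g: "eigfun g"
  shows "(LINT x|I01. g x) = 0"
proof -
  have "inner01 g (\<lambda>x. 1) = 0"
  proof (rule slap_AE_0_orthogonal[of _ mu _ 0])
    show "AE x in I01. slap w mu g x = 0" by (rule AE_I01_I) (use g in \<open>simp add: eigfun_def\<close>)
  qed (use eigfun_L2[OF g] slap_const mu_positive in auto)
  then show ?thesis using inner01_const[OF eigfun_L2[OF g], of 1] by simp
qed

text \<open>The combination h of g and \<open>f0\<close> is chosen to have equal values at 0 and 1.
  It is therefore constant, and zero by its mean; \<open>f0 0\<close> and \<open>f0 1\<close> being
  different allows solving for g.\<close>

lemma eigfun_multiple:
  assumes g: "eigfun g"
  obtains c where "\<And>x. x \<in> {0..1} \<Longrightarrow> g x = c * f0 x"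
proof -
  define h where "h = (\<lambda>x. (f0 1 - f0 0) * g x - (g 1 - g 0) * f0 x)"
  have h: "eigfun h" unfolding h_def by (intro eigfun_diff eigfun_scale g f0)
  have "h 0 = h 1" by (simp add: h_def algebra_simps)
  then have c: "\<And>x. x \<in> {0..1} \<Longrightarrow> h x = h 0" using eigfun_endpoints_eq_imp_const[OF h] by blast
  have "h 0 = 0" by (rule const_mean_0[OF c eigfun_mean[OF h]])
  then have "g x = ((g 1 - g 0) / (f0 1 - f0 0)) * f0 x" if "x \<in> {0..1}" for x
    using c[OF that] f0_endpoints by (simp add: h_def field_simps)
  then show thesis using that by blast
qed

lemma eigenspace_mu_multiple:
  assumes "f \<in> eigenspace w mu"
  shows "\<exists>c. ae_eq f (\<lambda>x. c * f0 x)"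
proof -
  obtain g where g: "eigfun g" and eq: "AE x in I01. f x = g x"
    using slap_AE_0_representative[of f] assms by (auto simp: eigenspace_iff)
  obtain c where "\<And>x. x \<in> {0..1} \<Longrightarrow> g x = c * f0 x" using eigfun_multiple[OF g] by blast
  then have "AE x in I01. g x = c * f0 x" by (rule AE_I01_I)
  with eq have "AE x in I01. f x = c * f0 x" by eventually_elim simp
  then show ?thesis by (auto simp: ae_eq_def)
qed

lemma f0_eigenspace: "f0 \<in> eigenspace w mu" "\<not> ae_eq f0 (\<lambda>x. 0)"
proof -
  show "f0 \<in> eigenspace w mu"
    using f0(1) f0_L2 by (auto simp: eigenspace_iff eigfun_def intro!: AE_I01_I)
  show "\<not> ae_eq f0 (\<lambda>x. 0)"
  proof
    assume "ae_eq f0 (\<lambda>x. 0)"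
    then have "inner01 f0 f0 = inner01 (\<lambda>x. 0) f0"
      using f0_L2 by (intro inner01_cong_AE) (auto simp: ae_eq_def)
    then show False using f0(3) by (simp add: inner01_def)
  qed
qed

lemma eigenset_1_f0: "eigenset {\<lambda>x. 1, f0}"
proof -
  have "slap w 0 f0 x = mu * f0 x" if "x \<in> {0..1}" for x
    using f0(1) that slap_shift[of 0 f0 x mu] by (simp add: eigfun_def)
  then show ?thesis using eigenset_1 f0_L2 by (auto simp: eigenset_def)
qed

text \<open>Without a gap the infimum 0 would be attained on this complement, by an eigenfunction
  for mu. That would be a multiple of \<open>f0\<close> orthogonal to \<open>f0\<close>, yet of norm
  1.\<close>

lemma spectral_gap:
  obtains e where "0 < e" "\<And>h. h \<in> perp {\<lambda>x. 1, f0} \<Longrightarrow> e * inner01 h h \<le> inner01 (slap w mu h) h"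
proof (rule ccontr)
  assume neg: "\<not> thesis"
  note gapI = that
  have psd': "0 \<le> inner01 (slap w mu h) h" if "h \<in> perp {\<lambda>x. 1, f0}" for h
    using that by (intro psd) (auto simp: perp_def)
  have inf: "\<exists>g\<in>perp {\<lambda>x. 1, f0}. inner01 g g = 1 \<and> inner01 (slap w mu g) g < e" if e: "0 < e" for e
  proof -
    obtain h where h: "h \<in> perp {\<lambda>x. 1, f0}" and lt: "inner01 (slap w mu h) h < e * inner01 h h"
      using neg gapI[OF e] by (meson not_le)
    have ne: "inner01 h h \<noteq> 0" using psd'[OF h] lt by auto
    then have "0 < inner01 h h" using inner01_self_nonneg[of h] by linarith
    then have "inner01 (slap w mu h) h / inner01 h h < e" using lt by (simp add: pos_divide_less_eq)
    then show ?thesis using normalize[OF h ne] by auto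
  qed
  obtain h where h: "h \<in> perp {\<lambda>x. 1, f0}" "inner01 h h = 1" "\<And>x. x \<in> {0..1} \<Longrightarrow> slap w mu h x = 0"
    using form_minimizer[OF eigenset_1_f0 psd' m_le mu_less inf] by blast
  have "eigfun h" using perp_L2[OF h(1)] h(3) by (rule slap_0_imp_eigfun)
  then obtain c where "\<And>x. x \<in> {0..1} \<Longrightarrow> h x = c * f0 x" using eigfun_multiple by blast
  then have "inner01 h h = inner01 h (\<lambda>x. c * f0 x)" by (intro inner01_cong) auto
  then show False using h by (simp add: perp_def)
qed

lemma in_resolvent_near:
  obtains e where "0 < e" "\<And>lam. lam < mu + e \<Longrightarrow> lam \<noteq> 0 \<Longrightarrow> lam \<noteq> mu \<Longrightarrow> in_resolvent w lam"
proof -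
  obtain e0 where e0: "0 < e0" and gap: "\<And>h. h \<in> perp {\<lambda>x. 1, f0} \<Longrightarrow> e0 * inner01 h h \<le> inner01 (slap w mu h) h"
    by (rule spectral_gap) blast
  \<comment> \<open>For lam < mu + e, the part \<open>e0\<close> keeps the coercivity constant
    positive and the part \<open>m - mu\<close> keeps lam below all degrees.\<close>
  define e where "e = min e0 (m - mu)"
  have e: "0 < e" using e0 mu_less by (simp add: e_def)
  have "in_resolvent w lam" if lam: "lam < mu + e" "lam \<noteq> 0" "lam \<noteq> mu" for lam
  proof -
    let ?U = "{\<lambda>x. 1, f0}"
    define c where "c = mu + e0 - lam"
    have c: "0 < c" "lam < m" using lam by (auto simp: c_def e_def)
    have coercive: "c * inner01 h h \<le> inner01 (slap w lam h) h" if h: "h \<in> perp ?U" for h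
      using gap[OF h] slap_form_shift[OF perp_L2[OF h], of lam mu] by (simp add: c_def algebra_simps)
    have f0s: "slap w mu f0 x = 0" if "x \<in> {0..1}" for x using f0(1) that by (simp add: eigfun_def)
    have surj: "\<exists>f\<in>L2. ae_eq (\<lambda>x. lap w f x - lam * f x) g" if g: "g \<in> L2" for g
    proof -
      define a where "a = inner01 g (\<lambda>x. 1)"
      define b where "b = inner01 g f0"
      define g' where "g' = (\<lambda>x. g x - (a + b * f0 x))"
      have L: "(\<lambda>x. a) \<in> L2" "(\<lambda>x. b * f0 x) \<in> L2" "(\<lambda>x. a + b * f0 x) \<in> L2" "(\<lambda>x. 1) \<in> L2"
        using f0_L2 by (auto intro: L2_scale L2_add)
      have a1: "inner01 (\<lambda>x. a) (\<lambda>x. 1) = a" by (simp add: inner01_def)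
      have a2: "inner01 (\<lambda>x. a) f0 = 0"
        using inner01_const[OF f0_L2, of a] f0_mean by (simp add: inner01_commute[of "\<lambda>x. a"])
      have "inner01 g' (\<lambda>x. 1) = 0" "inner01 g' f0 = 0"
        unfolding g'_def using f0
        by (simp_all add: inner01_diff_left[OF g L(3)] inner01_add_left[OF L(1,2)] L f0_L2 a1 a2 a_def[symmetric] b_def[symmetric])
      then have g'p: "g' \<in> perp ?U" using L2_diff[OF g L(3)] by (simp add: perp_def g'_def)
      obtain h where h: "h \<in> L2" "\<And>x. x \<in> {0..1} \<Longrightarrow> slap w lam h x = g' x"
        using slap_coercive_solve[OF eigenset_1_f0 c(1) coercive m_le c(2) g'p] by blast
      \<comment> \<open>On constants the shifted operator multiplies by -lam and on
        \<open>f0\<close> by mu - lam, so these two components of g are divided by nonzero numbers;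
        h solves for the remainder.\<close>
      define f where "f = (\<lambda>x. h x + (- a / lam + (b / (mu - lam)) * f0 x))"
      have Lf: "(\<lambda>x. (b / (mu - lam)) * f0 x) \<in> L2" "(\<lambda>x. - a / lam + (b / (mu - lam)) * f0 x) \<in> L2"
        by (intro L2_scale L2_add L2_const f0_L2)+
      have fL: "f \<in> L2" unfolding f_def by (rule L2_add[OF h(1) Lf(2)])
      have "slap w lam f x = g x" if x: "x \<in> {0..1}" for x
      proof -
        have "slap w lam f x = g' x + (- lam * (- a / lam) + (b / (mu - lam)) * slap w lam f0 x)"
          unfolding f_def slap_add[OF h(1) Lf(2) x] slap_add[OF L2_const Lf(1) x] slap_scale slap_const[OF x] h(2)[OF x] ..
        also have "slap w lam f0 x = (mu - lam) * f0 x"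
          using slap_shift[of lam f0 x mu] f0s[OF x] by simp
        finally show ?thesis using lam by (simp add: g'_def)
      qed
      then show ?thesis using fL by (auto simp: ae_eq_lap_iff intro!: AE_I01_I bexI[of _ f])
    qed
    have inj: "ae_eq f (\<lambda>x. 0)" if f: "f \<in> L2" and 0: "ae_eq (\<lambda>x. lap w f x - lam * f x) (\<lambda>x. 0)" for f
    proof -
      have s: "AE x in I01. slap w lam f x = 0" using 0 f by (simp add: ae_eq_lap_iff)
      have "inner01 f (\<lambda>x. 1) = 0"
        by (rule slap_AE_0_orthogonal[OF f s, of _ 0]) (use slap_const lam in auto)
      moreover have "inner01 f f0 = 0"
        by (rule slap_AE_0_orthogonal[OF f s f0_L2 f0s]) (use lam in auto)
      ultimately have "f \<in> perp ?U" using f by (simp add: perp_def)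
      from coercive[OF this] have "c * inner01 f f \<le> 0" using slap_AE_0_inner[OF f s f] by simp
      then have "inner01 f f = 0" using c inner01_self_nonneg[of f] by (simp add: mult_le_0_iff)
      then show ?thesis using inner01_self_eq_0[OF f] by (simp add: ae_eq_def)
    qed
    show ?thesis unfolding in_resolvent_def using surj inj by blast
  qed
  then show thesis using that e by blast
qed

lemma nonzero_eigenvalue_ge:
  assumes "is_eigenvalue w lam" "lam \<noteq> 0"
  shows "mu \<le> lam"
proof -
  obtain f where f: "f \<in> L2" "AE x in I01. slap w lam f x = 0" and ne: "\<not> ae_eq f (\<lambda>x. 0)"
    using assms by (auto simp: is_eigenvalue_def eigenspace_iff)
  have "inner01 f (\<lambda>x. 1) = 0"
    by (rule slap_AE_0_orthogonal[OF f, of _ 0]) (use slap_const assms in auto)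
  then have fp: "f \<in> perp {\<lambda>x. 1}" using f by (simp add: perp_def)
  have "0 \<le> (lam - mu) * inner01 f f"
    using psd[OF fp] slap_form_shift[OF f(1), of mu lam] slap_AE_0_inner[OF f f(1)] by simp
  moreover have "0 < inner01 f f"
    using inner01_self_eq_0[OF f(1)] ne inner01_self_nonneg[of f] by (auto simp: ae_eq_def order_less_le)
  ultimately show ?thesis by (simp add: zero_le_mult_iff)
qed

lemma discrete_0_mu: "0 \<in> discrete_eigenvalues w" "mu \<in> discrete_eigenvalues w"
proof -
  obtain e where e: "0 < e" and res: "\<And>lam. lam < mu + e \<Longrightarrow> lam \<noteq> 0 \<Longrightarrow> lam \<noteq> mu \<Longrightarrow> in_resolvent w lam"
    by (rule in_resolvent_near) blast
  have ev0: "is_eigenvalue w 0"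
    unfolding is_eigenvalue_def
  proof (rule bexI[of _ "\<lambda>x. 1"])
    show "\<not> ae_eq (\<lambda>x. 1) (\<lambda>x. 0)"
      using continuous_AE_0[of "\<lambda>x. 1" 0] by (auto simp: ae_eq_def)
    show "(\<lambda>x. 1) \<in> eigenspace w 0"
      by (auto simp: eigenspace_iff slap_const intro!: AE_I01_I)
  qed
  have evmu: "is_eigenvalue w mu" using f0_eigenspace by (auto simp: is_eigenvalue_def)
  have "finite_multiplicity w mu"
    unfolding finite_multiplicity_def
  proof (intro exI[of _ "{f0}"] conjI ballI)
    fix f assume "f \<in> eigenspace w mu"
    then obtain c where "ae_eq f (\<lambda>x. c * f0 x)" using eigenspace_mu_multiple by blast
    then show "\<exists>c. ae_eq f (\<lambda>x. \<Sum>g\<in>{f0}. c g * g x)" by (intro exI[of _ "\<lambda>g. c"]) simp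
  qed simp
  \<comment> \<open>The radius excludes 0 and stays within the range of lam covered by the resolvent
    result.\<close>
  moreover have "spectrum w \<inter> ball mu (min e mu) = {mu}"
  proof -
    have "lam = mu" if "lam \<in> spectrum w" "lam \<in> ball mu (min e mu)" for lam
      using that res[of lam] by (force simp: spectrum_def dist_real_def)
    then show ?thesis using eigenvalue_in_spectrum[OF evmu] e mu_positive by auto
  qed
  ultimately show "mu \<in> discrete_eigenvalues w"
    using evmu e mu_positive by (auto simp: discrete_eigenvalues_def intro!: exI[of _ "min e mu"])
  have "finite_multiplicity w 0"
    unfolding finite_multiplicity_def
  proof (intro exI[of _ "{\<lambda>x. 1}"] conjI ballI)
    fix f assume "f \<in> eigenspace w 0"
    then have f: "f \<in> L2" "AE x in I01. slap w 0 f x = 0" by (auto simp: eigenspace_iff)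
    define c where "c = (LINT x|I01. f x)"
    define h where "h = (\<lambda>x. f x - c)"
    have h: "h \<in> L2" unfolding h_def by (intro L2_diff f L2_const)
    have "(LINT x|I01. h x) = 0" using L2_integrable[OF f(1)] by (simp add: h_def c_def)
    then have hp: "h \<in> perp {\<lambda>x. 1}" using h inner01_const[OF h, of 1] by (simp add: perp_def)
    have hs: "AE x in I01. slap w 0 h x = 0"
      using f(2) AE_space[of I01]
    proof eventually_elim
      case (elim x)
      then show ?case using slap_diff[OF f(1) L2_const, of x 0 c] slap_const[of x 0 c] by (simp add: h_def)
    qed
    \<comment> \<open>The mean-zero part h of an eigenfunction for 0 has zero form at shift 0, hence
      form \<open>- mu * inner01 h h\<close> at shift mu, which cannot be negative.\<close>
    have "0 \<le> - mu * inner01 h h"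
      using psd[OF hp] slap_form_shift[OF h, of mu 0] slap_AE_0_inner[OF h hs h] by simp
    then have "inner01 h h = 0" using mu_positive inner01_self_nonneg[of h] by (simp add: mult_le_0_iff)
    then have "AE x in I01. h x = 0" by (rule inner01_self_eq_0[OF h])
    then have "ae_eq f (\<lambda>x. c)" by (simp add: ae_eq_def h_def)
    then show "\<exists>c. ae_eq f (\<lambda>x. \<Sum>g\<in>{\<lambda>x. 1}. c g * g x)" by (intro exI[of _ "\<lambda>g. c"]) simp
  qed simp
  moreover have "spectrum w \<inter> ball 0 mu = {0}"
  proof -
    have "lam = 0" if "lam \<in> spectrum w" "lam \<in> ball 0 mu" for lam
      using that res[of lam] e by (force simp: spectrum_def dist_real_def)
    then show ?thesis using eigenvalue_in_spectrum[OF ev0] mu_positive by auto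
  qed
  ultimately show "0 \<in> discrete_eigenvalues w"
    using ev0 mu_positive by (auto simp: discrete_eigenvalues_def intro!: exI[of _ mu])
qed

text \<open>No discrete eigenvalue lies below 0, so 0 has no predecessor; a value above mu would
  have at least two, namely 0 and mu.\<close>

lemma fiedler_value_eq_mu:
  assumes "fiedler_value w lam"
  shows "lam = mu"
proof -
  have d: "lam \<in> discrete_eigenvalues w" and u: "\<exists>!\<mu>. \<mu> \<in> discrete_eigenvalues w \<and> \<mu> < lam"
    using assms by (auto simp: fiedler_value_def)
  have ev: "is_eigenvalue w l" if "l \<in> discrete_eigenvalues w" for l
    using that by (simp add: discrete_eigenvalues_def)
  have "lam \<noteq> 0"
  proof
    assume "lam = 0"
    then obtain l where "l \<in> discrete_eigenvalues w" "l < 0" using u by auto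
    then show False using nonzero_eigenvalue_ge[OF ev, of l] mu_positive by auto
  qed
  then have "mu \<le> lam" using nonzero_eigenvalue_ge[OF ev[OF d]] by simp
  moreover have "\<not> mu < lam" using u discrete_0_mu mu_positive by (metis less_irrefl order_less_trans)
  ultimately show ?thesis by simp
qed

end

theorem mainTheorem3:
  fixes w :: "real \<Rightarrow> real \<Rightarrow> real" and lam2 :: real
  assumes "graphon w" and "robinsonian w"
    and "A1 w" and "A2 w" and "A3 w" and "A4 w"
    and "fiedler_value w lam2"
  shows "one_dimensional (eigenspace w lam2)"
proof -
  obtain K where K: "0 < K" and lip: "\<forall>x\<in>{0..1}. \<forall>y\<in>{0..1}. \<forall>x'\<in>{0..1}. \<forall>y'\<in>{0..1}.
      \<bar>w x y - w x' y'\<bar> \<le> K * (\<bar>x - x'\<bar> + \<bar>y - y'\<bar>)"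
    using assms(3) unfolding A1_def by blast
  interpret lipschitz_graphon w K
  proof
    show "\<bar>w x y - w x' y\<bar> \<le> K * \<bar>x - x'\<bar>" if "x \<in> {0..1}" "x' \<in> {0..1}" "y \<in> {0..1}" for x x' y
      using lip[rule_format, OF that(1,3,2,3)] by simp
  qed (use assms(1) K in \<open>auto simp: graphon_def\<close>)
  define m where "m = (INF x\<in>{0..1}. degree w x)"
  have m: "m \<le> degree w x" if "x \<in> {0..1}" for x
    unfolding m_def using degree_nonneg that by (intro cINF_lower bdd_belowI2[where m = 0]) auto
  interpret fiedler_graphon w K rayleigh m
  proof
    show "rayleigh < m" using assms(6) by (simp add: A4_def rayleigh_def m_def)
  qed (use assms m rayleigh_psd in auto)
  obtain h where h: "h \<in> perp {\<lambda>x. 1}" "inner01 h h = 1" "\<And>x. x \<in> {0..1} \<Longrightarrow> slap w rayleigh h x = 0"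
    using form_minimizer[OF eigenset_1 psd m_le mu_less rayleigh_approx] by blast
  interpret fiedler_function w K rayleigh m h
  proof
    show "eigfun h" using perp_L2[OF h(1)] h(3) by (rule slap_0_imp_eigfun)
  qed (use h in \<open>auto simp: perp_def\<close>)
  \<comment> \<open>Everything so far concerns the infimum; only here is the given Fiedler value
    identified with it.\<close>
  have "lam2 = rayleigh" using assms(7) by (rule fiedler_value_eq_mu)
  then show ?thesis
    unfolding one_dimensional_def using f0_eigenspace eigenspace_mu_multiple by blast
qed

end
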